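(* Let $n\ge 2$, let $h:[n]\to[n]$ be a Hessenberg function and let $\lambda=(\lambda_1,\lambda_2)$ be a composition of $n$ with two positive parts. Assume $h(1)<\lambda_2$. If $\lambda_1>1$, assume also that $h(\lambda_2+1)=n$ and $h(v_{\lambda_2-1}^{-1}(j_0))\le\lambda_2+1$, where $j_0=\min\{b\in\{\lambda_1+1,\dots,n-1\}: \lambda_2\le h(v_{\lambda_2-1}^{-1}(b))\}$. Then, for the class $f^{(\lambda_2-1)}_\lambda\in H^*_T(\mathrm{Hess}(\mathsf S,h))$: (1) the $S_n$-orbit $\{v\cdot f^{(\lambda_2-1)}_\lambda: v\in S_n\}$ under the dot action is linearly independent over $H^*_T(\mathrm{pt})=\mathbb{C}[t_1,\dots,t_n]$; (2) the stabilizer in $S_n$ of each element of this orbit is a conjugate of the Young subgroup $S_\lambda$. In particular, the $H^*_T(\mathrm{pt})$-submodule of $H^*_T(\mathrm{Hess}(\mathsf S,h))$ spanned by this orbit is an $S_n$-subrepresentation with the same character as $\mathrm{Ind}_{S_\lambda}^{S_n}(\mathbf 1)\simeq M^{\mathrm{Par}(\lambda)}$, where $\mathrm{Par}(\lambda)$ is the partition obtained by sorting the parts of $\lambda$ in decreasing order.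
   Context: Notation: $[n]=\{1,\dots,n\}$. A Hessenberg function is a nondecreasing map $h:[n]\to[n]$ with $h(i)\ge i$. $S_n$ acts on $\mathbb{C}[t_1,\dots,t_n]$ by ring automorphisms with $v(t_i)=t_{v(i)}$. $\Phi^+=\{t_i-t_j:i<j\}$, $\Phi^-=\{t_i-t_j:i>j\}$, $\Phi_h^-=\{t_i-t_j:i>j,\ i\le h(j)\}$, $N^-(w)=\{\gamma\in\Phi^-:w(\gamma)\in\Phi^+\}$, $N_h^-(w)=N^-(w)\cap\Phi_h^-$; $s_\gamma$ for $\gamma=t_i-t_j$ is the transposition of $i,j$; $s_i$ the transposition of $i,i+1$. For a regular semisimple matrix $\mathsf S$, $\mathrm{Hess}(\mathsf S,h)=\{$full flags $V_\bullet$ in $\mathbb{C}^n$ with $\mathsf SV_i\subseteq V_{h(i)}\}$; its $T$-equivariant cohomology ($T$ the diagonal torus, complex coefficients) is identified via GKM theory with the tuples $(f(w))_{w\in S_n}$ of polynomials such that for all $w$ and all $\gamma=t_i-t_j\in N_h^-(w)$, $t_{w(i)}-t_{w(j)}$ divides $f(w)-f(ws_\gamma)$, a module over $H^*_T(\mathrm{pt})=\mathbb{C}[t_1,\dots,t_n]$ componentwise. The dot action is $(v\cdot f)(w)=v(f(v^{-1}w))$. Bruhat order is $\le$. $S_\lambda$ is generated by $s_i$, $i\ne\lambda_1$. ${}^\lambda S_n=\{v: v^{-1}(1)<\dots<v^{-1}(\lambda_1),\ v^{-1}(\lambda_1+1)<\dots<v^{-1}(n)\}$; each $w\in S_n$ is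 uniquely $yv$ with $y\in S_\lambda$, $v\in{}^\lambda S_n$. For $0\le k\le\lambda_2$, $v_k$ has one-line notation $[\lambda_1+1,\dots,\lambda_1+k,1,\lambda_1+k+1,\dots,n,2,\dots,\lambda_1]$; in particular $v_{\lambda_2-1}^{-1}=[\lambda_2,\lambda_2+2,\dots,n,1,2,\dots,\lambda_2-1,\lambda_2+1]$. $\mathcal S_k=\{t_a-t_b:a<b,\ v_k^{-1}(a)>v_k^{-1}(b),\ v_k^{-1}(a)\le h(v_k^{-1}(b))\}$, and $f^{(k)}_\lambda(yv)=\prod_{t_a-t_b\in\mathcal S_k}(t_{y(a)}-t_{y(b)})$ if $v\ge v_k$ and $0$ otherwise ($y\in S_\lambda$, $v\in{}^\lambda S_n$); under the hypotheses of the claim $f^{(\lambda_2-1)}_\lambda$ satisfies the GKM conditions. *)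

theory Defs
  imports
    Complex_Main
    "HOL-Library.Poly_Mapping"
    "HOL-Library.Function_Algebras"
    "HOL-Algebra.Sym_Groups"
    "HOL-Algebra.Group_Action"
begin

text \<open>
  Permutations of \<open>{1..n}\<close> are functions \<open>nat \<Rightarrow> nat\<close> with \<open>w permutes {1..n}\<close>;
  products are compositions, \<open>(y \<circ> v) i = y (v i)\<close>. A root \<open>t\<^sub>i - t\<^sub>j\<close> is encoded
  by the pair \<open>(i, j)\<close>. Every tuple indexed by the symmetric group is a function on
  \<open>nat \<Rightarrow> nat\<close> that vanishes off the permutations of \<open>{1..n}\<close>, so that equality of
  functions is equality of tuples.
\<close>

subsection \<open>Polynomials\<close>

text \<open>
  A polynomial maps exponent vectors, finitely supported functions from variable indices
  to exponents, to coefficients.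
\<close>

type_synonym cpoly = "(nat \<Rightarrow>\<^sub>0 nat) \<Rightarrow>\<^sub>0 complex"

definition tvar :: "nat \<Rightarrow> cpoly" where
  "tvar i = Poly_Mapping.single (Poly_Mapping.single i 1) 1"

definition pconst :: "complex \<Rightarrow> cpoly" where
  "pconst c = Poly_Mapping.single 0 c"

text \<open>The ring \<open>\<complex>[t\<^sub>1, \<dots>, t\<^sub>n]\<close>, inside the polynomials in all variables \<open>t\<^sub>i\<close>.\<close>

definition polyring :: "nat \<Rightarrow> cpoly set" where
  "polyring n = {p. \<forall>m\<in>Poly_Mapping.keys p. Poly_Mapping.keys m \<subseteq> {1..n}}"

text \<open>The ring endomorphism over \<open>\<complex>\<close> with \<open>t\<^sub>i \<mapsto> t\<^bsub>v i\<^esub>\<close>.\<close>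

definition perm_poly :: "(nat \<Rightarrow> nat) \<Rightarrow> cpoly \<Rightarrow> cpoly" where
  "perm_poly v p =
     (\<Sum>m\<in>Poly_Mapping.keys p. pconst (Poly_Mapping.lookup p m) *
        (\<Prod>i\<in>Poly_Mapping.keys m. tvar (v i) ^ Poly_Mapping.lookup m i))"

subsection \<open>Equivariant cohomology of regular semisimple Hessenberg varieties\<close>

definition hessenberg_fun :: "nat \<Rightarrow> (nat \<Rightarrow> nat) \<Rightarrow> bool" where
  "hessenberg_fun n h \<longleftrightarrow>
     h \<in> {1..n} \<rightarrow> {1..n} \<and> mono_on {1..n} h \<and> (\<forall>i\<in>{1..n}. i \<le> h i)"

definition Phi_h_neg :: "nat \<Rightarrow> (nat \<Rightarrow> nat) \<Rightarrow> (nat \<times> nat) set" where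
  "Phi_h_neg n h = {(i, j). i \<in> {1..n} \<and> j \<in> {1..n} \<and> i > j \<and> i \<le> h j}"

definition N_h_neg :: "nat \<Rightarrow> (nat \<Rightarrow> nat) \<Rightarrow> (nat \<Rightarrow> nat) \<Rightarrow> (nat \<times> nat) set" where
  "N_h_neg n h w = {(i, j) \<in> Phi_h_neg n h. w i < w j}"

definition HT :: "nat \<Rightarrow> (nat \<Rightarrow> nat) \<Rightarrow> ((nat \<Rightarrow> nat) \<Rightarrow> cpoly) set" where
  "HT n h = {f.
     (\<forall>w. \<not> w permutes {1..n} \<longrightarrow> f w = 0) \<and>
     (\<forall>w. w permutes {1..n} \<longrightarrow> f w \<in> polyring n) \<and>
     (\<forall>w. w permutes {1..n} \<longrightarrow> (\<forall>(i, j)\<in>N_h_neg n h w.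
        \<exists>q\<in>polyring n.
          f w - f (w \<circ> Transposition.transpose i j) = (tvar (w i) - tvar (w j)) * q))}"

definition psmult :: "cpoly \<Rightarrow> ('w \<Rightarrow> cpoly) \<Rightarrow> 'w \<Rightarrow> cpoly" where
  "psmult p f = (\<lambda>w. p * f w)"

definition dot :: "(nat \<Rightarrow> nat) \<Rightarrow> ((nat \<Rightarrow> nat) \<Rightarrow> cpoly) \<Rightarrow> (nat \<Rightarrow> nat) \<Rightarrow> cpoly" where
  "dot v f = (\<lambda>w. perm_poly v (f (inv' v \<circ> w)))"

text \<open>
  The set version of independence is the right one for an orbit: distinct group elements
  may give the same element of the orbit.
\<close>

definition poly_independent :: "nat \<Rightarrow> ('w \<Rightarrow> cpoly) set \<Rightarrow> bool" where
  "poly_independent n S \<longleftrightarrow>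
     (\<forall>F c. finite F \<longrightarrow> F \<subseteq> S \<longrightarrow> c \<in> F \<rightarrow> polyring n \<longrightarrow>
        (\<Sum>x\<in>F. psmult (c x) x) = 0 \<longrightarrow> (\<forall>x\<in>F. c x = 0))"

definition poly_span :: "nat \<Rightarrow> ('w \<Rightarrow> cpoly) set \<Rightarrow> ('w \<Rightarrow> cpoly) set" where
  "poly_span n S =
     {\<Sum>x\<in>F. psmult (c x) x | F c. finite F \<and> F \<subseteq> S \<and> c \<in> F \<rightarrow> polyring n}"

definition HT_subrep :: "nat \<Rightarrow> (nat \<Rightarrow> nat) \<Rightarrow> ((nat \<Rightarrow> nat) \<Rightarrow> cpoly) set \<Rightarrow> bool" where
  "HT_subrep n h N \<longleftrightarrow>
     N \<subseteq> HT n h \<and> 0 \<in> N \<and>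
     (\<forall>f\<in>N. \<forall>g\<in>N. f + g \<in> N) \<and>
     (\<forall>p\<in>polyring n. \<forall>f\<in>N. psmult p f \<in> N) \<and>
     (\<forall>v. v permutes {1..n} \<longrightarrow> (\<forall>f\<in>N. dot v f \<in> N))"

subsection \<open>The classes attached to a composition with two parts\<close>

definition inversion_number :: "nat \<Rightarrow> (nat \<Rightarrow> nat) \<Rightarrow> nat" where
  "inversion_number n w = card {(i, j). i \<in> {1..n} \<and> j \<in> {1..n} \<and> i < j \<and> w i > w j}"

text \<open>\<open>bruhat_le n u v\<close>: some length-increasing chain of reflections leads from \<open>u\<close> to \<open>v\<close>.\<close>

definition bruhat_le :: "nat \<Rightarrow> (nat \<Rightarrow> nat) \<Rightarrow> (nat \<Rightarrow> nat) \<Rightarrow> bool" where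
  "bruhat_le n u v \<longleftrightarrow>
     (u, v) \<in> {(w, w \<circ> Transposition.transpose i j) | w i j.
                 w permutes {1..n} \<and> i \<in> {1..n} \<and> j \<in> {1..n} \<and>
                 inversion_number n w < inversion_number n (w \<circ> Transposition.transpose i j)}\<^sup>*"

definition young_subgroup :: "nat \<Rightarrow> nat \<Rightarrow> (nat \<Rightarrow> nat) set" where
  "young_subgroup n l1 =
     generate (sym_group n) {Transposition.transpose i (i + 1) | i. 1 \<le> i \<and> i < n \<and> i \<noteq> l1}"

definition coset_reps :: "nat \<Rightarrow> nat \<Rightarrow> (nat \<Rightarrow> nat) set" where
  "coset_reps n l1 = {v. v permutes {1..n} \<and>
     strict_mono_on {1..l1} (inv' v) \<and> strict_mono_on {l1 + 1..n} (inv' v)}"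

definition one_line :: "nat list \<Rightarrow> nat \<Rightarrow> nat" where
  "one_line xs i = (if i \<in> {1..length xs} then xs ! (i - 1) else i)"

definition vperm :: "nat \<Rightarrow> nat \<Rightarrow> nat \<Rightarrow> nat \<Rightarrow> nat" where
  "vperm n l1 k =
     one_line ([l1 + 1..<l1 + k + 1] @ [1] @ [l1 + k + 1..<n + 1] @ [2..<l1 + 1])"

definition Sset :: "nat \<Rightarrow> (nat \<Rightarrow> nat) \<Rightarrow> nat \<Rightarrow> nat \<Rightarrow> (nat \<times> nat) set" where
  "Sset n h l1 k = {(a, b). a \<in> {1..n} \<and> b \<in> {1..n} \<and> a < b \<and>
     inv' (vperm n l1 k) a > inv' (vperm n l1 k) b \<and>
     inv' (vperm n l1 k) a \<le> h (inv' (vperm n l1 k) b)}"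

definition fclass :: "nat \<Rightarrow> (nat \<Rightarrow> nat) \<Rightarrow> nat \<Rightarrow> nat \<Rightarrow> (nat \<Rightarrow> nat) \<Rightarrow> cpoly" where
  "fclass n h l1 k w =
     (if w permutes {1..n} then
        let (y, v) = (THE (y, v). y \<in> young_subgroup n l1 \<and> v \<in> coset_reps n l1 \<and> w = y \<circ> v)
        in if bruhat_le n (vperm n l1 k) v
           then \<Prod>(a, b)\<in>Sset n h l1 k. tvar (y a) - tvar (y b)
           else 0
      else 0)"

subsection \<open>Characters\<close>

text \<open>
  For complex vector spaces \<open>W \<subseteq> V\<close> (with scalar multiplication \<open>s\<close>) and \<open>L\<close> mapping \<open>V\<close>
  to \<open>V\<close> and \<open>W\<close> to \<open>W\<close>, \<open>quot_trace s V W L\<close> is the trace of the map induced on \<open>V/W\<close>,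
  provided the latter has finite dimension. It is computed in a basis of \<open>V/W\<close> given by
  representatives in \<open>V\<close>; the trace does not depend on this choice.
\<close>

definition is_quot_basis ::
    "(complex \<Rightarrow> 'a \<Rightarrow> 'a::ab_group_add) \<Rightarrow> 'a set \<Rightarrow> 'a set \<Rightarrow> 'a set \<Rightarrow> bool" where
  "is_quot_basis s V W B \<longleftrightarrow> finite B \<and> B \<subseteq> V \<and>
     (\<forall>x\<in>V. \<exists>!c. c \<in> extensional B \<and> x - (\<Sum>b\<in>B. s (c b) b) \<in> W)"

definition quot_coord ::
    "(complex \<Rightarrow> 'a \<Rightarrow> 'a::ab_group_add) \<Rightarrow> 'a set \<Rightarrow> 'a set \<Rightarrow> 'a \<Rightarrow> 'a \<Rightarrow> complex" where
  "quot_coord s W B x = (THE c. c \<in> extensional B \<and> x - (\<Sum>b\<in>B. s (c b) b) \<in> W)"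

definition quot_trace ::
    "(complex \<Rightarrow> 'a \<Rightarrow> 'a::ab_group_add) \<Rightarrow> 'a set \<Rightarrow> 'a set \<Rightarrow> ('a \<Rightarrow> 'a) \<Rightarrow> complex" where
  "quot_trace s V W L =
     (let B = (SOME B. is_quot_basis s V W B) in \<Sum>b\<in>B. quot_coord s W B (L b) b)"

text \<open>
  The dot action is only semilinear over \<open>\<complex>[t\<^sub>1, \<dots>, t\<^sub>n]\<close>, as
  \<open>v \<cdot> (p f) = v(p) (v \<cdot> f)\<close>, so the trace of its matrix in a basis over this ring depends
  on the basis. The character of a submodule \<open>N\<close> is therefore that of the complex
  representation \<open>N / (t\<^sub>1, \<dots>, t\<^sub>n) N\<close>; if \<open>N\<close> is free, the dimension of this
  space is the rank of \<open>N\<close>, and a basis of \<open>N\<close> permuted by the group becomes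
  a basis of it permuted in the same way.
\<close>

definition augmented :: "nat \<Rightarrow> ('w \<Rightarrow> cpoly) set \<Rightarrow> ('w \<Rightarrow> cpoly) set" where
  "augmented n N = {\<Sum>i\<in>{1..n}. psmult (tvar i) (g i) | g. g \<in> {1..n} \<rightarrow> N}"

definition HT_character :: "nat \<Rightarrow> ((nat \<Rightarrow> nat) \<Rightarrow> cpoly) set \<Rightarrow> (nat \<Rightarrow> nat) \<Rightarrow> complex" where
  "HT_character n N v = quot_trace (\<lambda>c. psmult (pconst c)) N (augmented n N) (dot v)"

definition fscale :: "complex \<Rightarrow> ('x \<Rightarrow> complex) \<Rightarrow> 'x \<Rightarrow> complex" where
  "fscale c f = (\<lambda>x. c * f x)"

text \<open>
  The representation induced from the trivial representation of a subgroup \<open>H\<close>: functions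
  on the symmetric group constant on left cosets of \<open>H\<close>, under left translation.
\<close>

definition ind_trivial :: "nat \<Rightarrow> (nat \<Rightarrow> nat) set \<Rightarrow> ((nat \<Rightarrow> nat) \<Rightarrow> complex) set" where
  "ind_trivial n H = {f. (\<forall>w. \<not> w permutes {1..n} \<longrightarrow> f w = 0) \<and>
     (\<forall>w. w permutes {1..n} \<longrightarrow> (\<forall>y\<in>H. f (w \<circ> y) = f w))}"

definition left_translate ::
    "(nat \<Rightarrow> nat) \<Rightarrow> ((nat \<Rightarrow> nat) \<Rightarrow> complex) \<Rightarrow> (nat \<Rightarrow> nat) \<Rightarrow> complex" where
  "left_translate v f = (\<lambda>w. f (inv' v \<circ> w))"

definition ind_character :: "nat \<Rightarrow> (nat \<Rightarrow> nat) set \<Rightarrow> (nat \<Rightarrow> nat) \<Rightarrow> complex" where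
  "ind_character n H v = quot_trace fscale (ind_trivial n H) {0} (left_translate v)"

text \<open>
  The permutation module \<open>M\<^sup>\<mu>\<close> on tabloids of shape \<open>\<mu>\<close>; a tabloid is the list of its
  rows, and a function stands for the linear combination of tabloids with these coefficients.
\<close>

definition tabloids :: "nat \<Rightarrow> nat list \<Rightarrow> nat set list set" where
  "tabloids n mu = {T. length T = length mu \<and> (\<forall>i<length mu. card (T ! i) = mu ! i) \<and>
     (\<forall>i<length mu. \<forall>j<length mu. i \<noteq> j \<longrightarrow> T ! i \<inter> T ! j = {}) \<and> \<Union> (set T) = {1..n}}"

definition perm_module :: "nat \<Rightarrow> nat list \<Rightarrow> (nat set list \<Rightarrow> complex) set" where
  "perm_module n mu = {f. \<forall>T. T \<notin> tabloids n mu \<longrightarrow> f T = 0}"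

definition tabloid_act ::
    "(nat \<Rightarrow> nat) \<Rightarrow> (nat set list \<Rightarrow> complex) \<Rightarrow> nat set list \<Rightarrow> complex" where
  "tabloid_act v f = (\<lambda>T. f (map ((`) (inv' v)) T))"

definition rep_iso :: "nat \<Rightarrow>
    ('x \<Rightarrow> complex) set \<Rightarrow> ((nat \<Rightarrow> nat) \<Rightarrow> ('x \<Rightarrow> complex) \<Rightarrow> 'x \<Rightarrow> complex) \<Rightarrow>
    ('y \<Rightarrow> complex) set \<Rightarrow> ((nat \<Rightarrow> nat) \<Rightarrow> ('y \<Rightarrow> complex) \<Rightarrow> 'y \<Rightarrow> complex) \<Rightarrow> bool" where
  "rep_iso n V a V' a' \<longleftrightarrow> (\<exists>\<Phi>. bij_betw \<Phi> V V' \<and>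
     (\<forall>x\<in>V. \<forall>y\<in>V. \<Phi> (x + y) = \<Phi> x + \<Phi> y) \<and>
     (\<forall>c. \<forall>x\<in>V. \<Phi> (fscale c x) = fscale c (\<Phi> x)) \<and>
     (\<forall>v. v permutes {1..n} \<longrightarrow> (\<forall>x\<in>V. \<Phi> (a v x) = a' v (\<Phi> x))))"

definition Par :: "nat list \<Rightarrow> nat list" where
  "Par l = rev (sort l)"

end

theory Submission
  imports Defs
begin

text \<open>
  An element \<open>v\<close> of \<open>coset_reps n l1\<close> is determined by the set \<open>inv' v ` {1..l1}\<close>, and for
  \<open>k = l2 - 1\<close> only two of them lie above \<open>v\<^sub>k\<close>: \<open>v\<^sub>k\<close> itself, with the set
  \<open>A2 = {l2, l2 + 2, \<dots>, n}\<close>, and \<open>v\<^sub>k \<circ> s\<^bsub>l2\<^esub>\<close>, with \<open>A1 = {l2 + 1, \<dots>, n}\<close>. Hence the translate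
  of the class by \<open>u\<close> depends only on \<open>I = u ` {1..l1}\<close>, and its value at \<open>w\<close> is \<open>0\<close> unless
  \<open>w ` A2 = I\<close> or \<open>w ` A1 = I\<close>, in which case it is a product of differences of the \<open>t\<^bsub>w i\<^esub>\<close>.
  So every \<open>w\<close> gives a linear relation between only two coefficients of a vanishing combination.
  Let \<open>C0\<close> be the set of \<open>p < l2\<close> with \<open>l2 \<le> h p\<close>; the hypothesis \<open>h 1 < l2\<close> says that \<open>1\<close> is not
  in it. If \<open>p \<in> C0\<close>, the relations at \<open>w\<close> and \<open>w \<circ> (1 p)\<close> involve the same two coefficients and
  have nonzero determinant. If \<open>C0\<close> is empty, the relations at \<open>w\<close>, \<open>w \<circ> (1 l2)\<close> and
  \<open>w \<circ> (1 (l2 + 1))\<close> connect three coefficients in a triangle, and their signs force all of them to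
  vanish. The orbit is thus a basis of its span, permuted like the \<open>l1\<close>-element subsets of \<open>{1..n}\<close>,
  and all characters count the subsets fixed by a permutation.
\<close>

subsection \<open>Polynomials and the action of permutations on them\<close>

lemma polyring_0 [simp]: "0 \<in> polyring n"
  by (simp add: polyring_def)

lemma polyring_1 [simp]: "1 \<in> polyring n"
  by (simp add: polyring_def)

lemma polyring_pconst [simp]: "pconst c \<in> polyring n"
  by (simp add: polyring_def pconst_def)

lemma polyring_tvar [simp]: "i \<in> {1..n} \<Longrightarrow> tvar i \<in> polyring n"
  by (simp add: polyring_def tvar_def)

lemma polyring_add [simp]: "p \<in> polyring n \<Longrightarrow> q \<in> polyring n \<Longrightarrow> p + q \<in> polyring n"
  using Poly_Mapping.keys_add[of p q] by (auto simp: polyring_def)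

lemma polyring_uminus [simp]: "p \<in> polyring n \<Longrightarrow> - p \<in> polyring n"
  by (simp add: polyring_def in_keys_iff)

lemma polyring_diff [simp]: "p \<in> polyring n \<Longrightarrow> q \<in> polyring n \<Longrightarrow> p - q \<in> polyring n"
  using polyring_add[of p n "- q"] by simp

lemma polyring_mult [simp]:
  assumes "p \<in> polyring n" "q \<in> polyring n" shows "p * q \<in> polyring n"
  unfolding polyring_def
proof (standard, standard)
  fix m assume "m \<in> Poly_Mapping.keys (p * q)"
  then obtain a b where "a \<in> Poly_Mapping.keys p" "b \<in> Poly_Mapping.keys q" "m = a + b"
    using keys_mult[of p q] by blast
  moreover have "Poly_Mapping.keys (a + b) \<subseteq> Poly_Mapping.keys a \<union> Poly_Mapping.keys b"
    by (rule Poly_Mapping.keys_add)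
  ultimately show "Poly_Mapping.keys m \<subseteq> {1..n}"
    using assms by (fastforce simp: polyring_def)
qed

lemma polyring_sum [simp]: "(\<And>i. i \<in> A \<Longrightarrow> f i \<in> polyring n) \<Longrightarrow> sum f A \<in> polyring n"
  by (induction A rule: infinite_finite_induct) auto

lemma polyring_prod [simp]: "(\<And>i. i \<in> A \<Longrightarrow> f i \<in> polyring n) \<Longrightarrow> prod f A \<in> polyring n"
  by (induction A rule: infinite_finite_induct) auto

lemma polyring_power [simp]: "p \<in> polyring n \<Longrightarrow> p ^ k \<in> polyring n"
  by (induction k) auto

lemma pconst_0 [simp]: "pconst 0 = 0"
  by (simp add: pconst_def)

lemma pconst_1 [simp]: "pconst 1 = 1"
  by (simp add: pconst_def)

lemma pconst_add: "pconst (a + b) = pconst a + pconst b"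
  by (simp add: pconst_def single_add)

lemma pconst_mult: "pconst (a * b) = pconst a * pconst b"
  by (simp add: pconst_def mult_single)

lemma lookup_pconst_0 [simp]: "Poly_Mapping.lookup (pconst c) 0 = c"
  by (simp add: pconst_def)

lemma tvar_inject [simp]: "tvar i = tvar j \<longleftrightarrow> i = j"
proof
  assume "tvar i = tvar j"
  then have "Poly_Mapping.keys (tvar i) = Poly_Mapping.keys (tvar j)" by simp
  then have "Poly_Mapping.single i (1::nat) = Poly_Mapping.single j 1"
    by (simp add: tvar_def)
  then have "Poly_Mapping.keys (Poly_Mapping.single i (1::nat)) = Poly_Mapping.keys (Poly_Mapping.single j (1::nat))"
    by simp
  then show "i = j" by simp
qed simp

text \<open>Every exponent vector of \<open>tvar i * q\<close> has a positive entry at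
  \<open>i\<close>. The coefficient at \<open>0\<close> is the augmentation of a polynomial, so the
  ideal of the variables lies in its kernel.\<close>

lemma lookup_tvar_mult_0 [simp]: "Poly_Mapping.lookup (tvar i * q) 0 = 0"
proof (rule ccontr)
  assume "Poly_Mapping.lookup (tvar i * q) 0 \<noteq> 0"
  then obtain b where b: "0 = Poly_Mapping.single i (1::nat) + b"
    using keys_mult[of "tvar i" q] by (auto simp: tvar_def in_keys_iff)
  then have "Poly_Mapping.lookup (Poly_Mapping.single i (1::nat) + b) i = 0"
    by (metis lookup_zero)
  then show False by (simp add: lookup_add)
qed

lemma sum_singles:
  "p = (\<Sum>m\<in>Poly_Mapping.keys p. Poly_Mapping.single m (Poly_Mapping.lookup p m))"
  by (rule poly_mapping_eqI) (auto simp: lookup_sum lookup_single when_def in_keys_iff)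

text \<open>A monomial other than \<open>1\<close> is divisible by one of its variables, and the
  property is additive. Thus the kernel of the augmentation is generated by the variables, which
  later describes \<open>augmented n N\<close> by constant terms.\<close>

lemma polyring_decompose:
  assumes "p \<in> polyring n"
  shows "\<exists>q. q \<in> {1..n} \<rightarrow> polyring n \<and>
           p = pconst (Poly_Mapping.lookup p 0) + (\<Sum>i\<in>{1..n}. tvar i * q i)"
proof -
  let ?P = "\<lambda>p. \<exists>q. q \<in> {1..n} \<rightarrow> polyring n \<and>
    p = pconst (Poly_Mapping.lookup p 0) + (\<Sum>i\<in>{1..n}. tvar i * q i)"
  have single: "?P (Poly_Mapping.single m c)" if m: "Poly_Mapping.keys m \<subseteq> {1..n}" for m c
  proof (cases "m = 0")
    case True
    then show ?thesis by (intro exI[of _ "\<lambda>_. 0"]) (simp add: pconst_def)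
  next
    case False
    then obtain i where i: "i \<in> Poly_Mapping.keys m" by fastforce
    \<comment> \<open>One factor with index \<open>i\<close> is split off; the truncated subtraction
      is exact because \<open>i\<close> occurs in \<open>m\<close>.\<close>
    define m' where "m' = m - Poly_Mapping.single i 1"
    have m'_lookup: "Poly_Mapping.lookup m' k = Poly_Mapping.lookup m k - (if k = i then 1 else 0)" for k
      by (simp add: m'_def lookup_minus lookup_single when_def)
    have m_eq: "m = Poly_Mapping.single i 1 + m'"
      using i by (intro poly_mapping_eqI) (auto simp: lookup_add m'_lookup lookup_single when_def in_keys_iff)
    have keys: "Poly_Mapping.keys m' \<subseteq> {1..n}"
      using m by (auto simp: in_keys_iff m'_lookup split: if_splits)
    let ?q = "\<lambda>j. if j = i then Poly_Mapping.single m' c else 0"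
    have "(\<Sum>j\<in>{1..n}. tvar j * ?q j) = (\<Sum>j\<in>{1..n}. if j = i then tvar i * Poly_Mapping.single m' c else 0)"
      by (intro sum.cong) auto
    also have "\<dots> = tvar i * Poly_Mapping.single m' c"
      using i m by (subst sum.delta) auto
    also have "\<dots> = Poly_Mapping.single m c"
      by (simp add: tvar_def mult_single m_eq)
    finally show ?thesis
      using False keys by (intro exI[of _ ?q]) (auto simp: polyring_def lookup_single when_def)
  qed
  have add: "?P (a + b)" if ab: "?P a" "?P b" for a b
  proof -
    from ab obtain q r where "q \<in> {1..n} \<rightarrow> polyring n" "r \<in> {1..n} \<rightarrow> polyring n"
      and eq: "a = pconst (Poly_Mapping.lookup a 0) + (\<Sum>i\<in>{1..n}. tvar i * q i)"
        "b = pconst (Poly_Mapping.lookup b 0) + (\<Sum>i\<in>{1..n}. tvar i * r i)" by blast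
    moreover have "a + b = pconst (Poly_Mapping.lookup (a + b) 0) + (\<Sum>i\<in>{1..n}. tvar i * (q i + r i))"
      by (subst eq(1), subst eq(2)) (simp add: lookup_add pconst_add distrib_left sum.distrib)
    ultimately show ?thesis by (intro exI[of _ "\<lambda>i. q i + r i"]) (auto simp: Pi_iff)
  qed
  have "?P (\<Sum>m\<in>K. Poly_Mapping.single m (Poly_Mapping.lookup p m))"
    if "K \<subseteq> Poly_Mapping.keys p" "finite K" for K
    using that(2,1)
  proof (induction K rule: finite_induct)
    case empty
    show ?case by (intro exI[of _ "\<lambda>_. 0"]) simp
  next
    case (insert m K)
    have "Poly_Mapping.keys m \<subseteq> {1..n}"
      using insert.prems assms unfolding polyring_def by blast
    then show ?case
      using add[OF single insert.IH] insert.prems insert.hyps by simp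
  qed
  from this[OF order.refl] show ?thesis
    using sum_singles[of p] by simp
qed

section \<open>The substitution of variables as a ring homomorphism\<close>

definition monomial_image :: "(nat \<Rightarrow> nat) \<Rightarrow> (nat \<Rightarrow>\<^sub>0 nat) \<Rightarrow> cpoly" where
  "monomial_image v m = (\<Prod>i\<in>Poly_Mapping.keys m. tvar (v i) ^ Poly_Mapping.lookup m i)"

text \<open>Indices outside the keys contribute zeroth powers, so several monomials can be evaluated
  over one common index set.\<close>

lemma monomial_image_superset:
  assumes "finite K" "Poly_Mapping.keys m \<subseteq> K"
  shows "monomial_image v m = (\<Prod>i\<in>K. tvar (v i) ^ Poly_Mapping.lookup m i)"
  unfolding monomial_image_def using assms
  by (intro prod.mono_neutral_left) (auto simp: in_keys_iff)

lemma monomial_image_add: "monomial_image v (a + b) = monomial_image v a * monomial_image v b"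
proof -
  let ?K = "Poly_Mapping.keys a \<union> Poly_Mapping.keys b"
  show ?thesis
    using Poly_Mapping.keys_add[of a b]
    by (simp add: monomial_image_superset[of ?K] lookup_add power_add prod.distrib)
qed

lemma perm_poly_superset:
  assumes "finite K" "Poly_Mapping.keys p \<subseteq> K"
  shows "perm_poly v p = (\<Sum>m\<in>K. pconst (Poly_Mapping.lookup p m) * monomial_image v m)"
  unfolding perm_poly_def monomial_image_def[symmetric] using assms
  by (intro sum.mono_neutral_left) (auto simp: in_keys_iff)

lemma perm_poly_0 [simp]: "perm_poly v 0 = 0"
  by (simp add: perm_poly_def)

lemma perm_poly_add: "perm_poly v (p + q) = perm_poly v p + perm_poly v q"
proof -
  let ?K = "Poly_Mapping.keys p \<union> Poly_Mapping.keys q"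
  show ?thesis
    using Poly_Mapping.keys_add[of p q]
    by (simp add: perm_poly_superset[of ?K] lookup_add pconst_add distrib_right sum.distrib)
qed

lemma perm_poly_sum: "perm_poly v (sum f A) = (\<Sum>i\<in>A. perm_poly v (f i))"
  by (induction A rule: infinite_finite_induct) (auto simp: perm_poly_add)

lemma perm_poly_single: "perm_poly v (Poly_Mapping.single m c) = pconst c * monomial_image v m"
  by (subst perm_poly_superset[of "{m}"]) auto

text \<open>Both factors are expanded into monomials, and on monomials multiplication is addition of
  exponents.\<close>

lemma perm_poly_mult: "perm_poly v (p * q) = perm_poly v p * perm_poly v q"
proof -
  let ?s = "\<lambda>p m. Poly_Mapping.single m (Poly_Mapping.lookup p m)"
  have "p * q = (\<Sum>a\<in>Poly_Mapping.keys p. \<Sum>b\<in>Poly_Mapping.keys q. ?s p a * ?s q b)"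
    by (subst sum_singles[of p], subst sum_singles[of q]) (rule sum_product)
  then show ?thesis
    by (simp add: perm_poly_def[of v p] perm_poly_def[of v q] monomial_image_def[symmetric]
        sum_product perm_poly_sum mult_single perm_poly_single monomial_image_add pconst_mult mult_ac)
qed

lemma perm_poly_pconst [simp]: "perm_poly v (pconst c) = pconst c"
  by (simp add: pconst_def perm_poly_single monomial_image_def)

lemma perm_poly_1 [simp]: "perm_poly v 1 = 1"
  using perm_poly_pconst[of v 1] by simp

lemma perm_poly_tvar [simp]: "perm_poly v (tvar i) = tvar (v i)"
  unfolding tvar_def[of i] by (simp add: perm_poly_single monomial_image_def)

lemma perm_poly_uminus: "perm_poly v (- p) = - perm_poly v p"
  using perm_poly_add[of v p "- p"] by (simp add: eq_neg_iff_add_eq_0 add.commute)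

lemma perm_poly_diff: "perm_poly v (p - q) = perm_poly v p - perm_poly v q"
  using perm_poly_add[of v p "- q"] by (simp add: perm_poly_uminus)

lemma perm_poly_prod: "perm_poly v (prod f A) = (\<Prod>i\<in>A. perm_poly v (f i))"
  by (induction A rule: infinite_finite_induct) (auto simp: perm_poly_mult)

lemma perm_poly_polyring:
  assumes "p \<in> polyring n" "v permutes {1..n}"
  shows "perm_poly v p \<in> polyring n"
  unfolding perm_poly_def
proof (intro polyring_sum polyring_mult polyring_pconst polyring_prod polyring_power polyring_tvar)
  fix m i assume "m \<in> Poly_Mapping.keys p" "i \<in> Poly_Mapping.keys m"
  then have "i \<in> {1..n}" using assms(1) unfolding polyring_def by blast
  then show "v i \<in> {1..n}" using permutes_in_image[OF assms(2)] by blast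
qed

subsection \<open>Inversions, Young subgroups and coset representatives\<close>

abbreviation transposition :: "nat \<Rightarrow> nat \<Rightarrow> nat \<Rightarrow> nat" where
  "transposition \<equiv> Transposition.transpose"

definition inversions :: "nat \<Rightarrow> (nat \<Rightarrow> nat) \<Rightarrow> (nat \<times> nat) set" where
  "inversions n w = {(i, j). i \<in> {1..n} \<and> j \<in> {1..n} \<and> i < j \<and> w i > w j}"

lemma finite_inversions: "finite (inversions n w)"
  by (rule finite_subset[of _ "{1..n} \<times> {1..n}"]) (auto simp: inversions_def)

lemma inversion_number_card: "inversion_number n w = card (inversions n w)"
  by (simp add: inversion_number_def inversions_def)

text \<open>
  An inversion of \<open>w \<circ> transposition i j\<close> is sent to its image under \<open>transposition i j\<close> if that is an increasing
  pair and kept otherwise; this injection into the inversions of \<open>w\<close> misses \<open>(i, j)\<close>.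
\<close>

lemma inversion_number_transpose_less:
  assumes "i \<in> {1..n}" "j \<in> {1..n}" "i < j" "w i > w j"
  shows "inversion_number n (w \<circ> transposition i j) < inversion_number n w"
proof -
  let ?t = "transposition i j"
  define \<phi> where "\<phi> = (\<lambda>(p, q). if ?t p < ?t q then (?t p, ?t q) else (p, q))"
  have inj: "inj_on \<phi> (inversions n (w \<circ> ?t))"
  proof (rule inj_onI, clarify)
    fix p q p' q'
    assume *: "(p, q) \<in> inversions n (w \<circ> ?t)" "(p', q') \<in> inversions n (w \<circ> ?t)"
      "\<phi> (p, q) = \<phi> (p', q')"
    have "p < q" "p' < q'" using * by (auto simp: inversions_def)
    then show "p = p' \<and> q = q'"
      using *(3) by (auto simp: \<phi>_def inj_eq[OF inj_transpose] split: if_splits)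
  qed
  have sub: "\<phi> ` inversions n (w \<circ> ?t) \<subseteq> inversions n w - {(i, j)}"
  proof (rule image_subsetI, clarify)
    fix p q assume "(p, q) \<in> inversions n (w \<circ> ?t)"
    then have pq: "p \<in> {1..n}" "q \<in> {1..n}" "p < q" "w (?t p) > w (?t q)"
      by (auto simp: inversions_def)
    have "\<phi> (p, q) \<in> inversions n w \<and> \<phi> (p, q) \<noteq> (i, j)"
      using pq assms unfolding \<phi>_def inversions_def Transposition.transpose_def
      by (auto split: if_splits)
    then show "\<phi> (p, q) \<in> inversions n w - {(i, j)}" by simp
  qed
  have "(i, j) \<in> inversions n w" using assms by (simp add: inversions_def)
  then have "card (inversions n w - {(i, j)}) < card (inversions n w)"
    using finite_inversions by (intro psubset_card_mono) auto
  moreover have "card (inversions n (w \<circ> ?t)) \<le> card (inversions n w - {(i, j)})"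
    using inj sub finite_inversions by (intro card_inj_on_le[OF inj sub]) auto
  ultimately show ?thesis by (simp add: inversion_number_card)
qed

text \<open>If the larger value stood first, exchanging the two would lower the inversion number.
  This turns the length condition in \<open>bruhat_le\<close> into a comparison of two
  values.\<close>

lemma inversion_number_less_transposeD:
  assumes "i \<in> {1..n}" "j \<in> {1..n}" "i < j" "inj w"
    and "inversion_number n w < inversion_number n (w \<circ> transposition i j)"
  shows "w i < w j"
proof (rule ccontr)
  assume "\<not> w i < w j"
  moreover have "w i \<noteq> w j" using assms(3,4) by (auto dest: injD)
  ultimately have "inversion_number n (w \<circ> transposition i j) < inversion_number n w"
    by (intro inversion_number_transpose_less assms) simp
  then show False using assms(5) by simp
qed

text \<open>At the first disagreement, the smaller of the two values must be taken by the other
  function somewhere: earlier is excluded by agreement there, later by monotonicity.\<close>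

lemma strict_mono_on_image_unique:
  fixes f g :: "nat \<Rightarrow> nat"
  assumes "strict_mono_on A f" "strict_mono_on A g" "f ` A = g ` A" "x \<in> A"
  shows "f x = g x"
  using assms(4)
proof (induction x rule: less_induct)
  case (less x)
  \<comment> \<open>Stated for arbitrary \<open>f\<close> and \<open>g\<close>, so that exchanging
    their roles excludes both strict inequalities.\<close>
  have *: "\<not> f x < g x"
    if f: "strict_mono_on A f" and g: "strict_mono_on A g" and im: "f ` A = g ` A"
      and IH: "\<And>y. y < x \<Longrightarrow> y \<in> A \<Longrightarrow> f y = g y" for f g :: "nat \<Rightarrow> nat"
  proof
    assume fg: "f x < g x"
    obtain z where z: "z \<in> A" "f x = g z" using im less.prems by blast
    show False
    proof (cases "z < x")
      case True
      then have "f z < f x" using strict_mono_onD[OF f z(1) less.prems] by blast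
      then show False using IH[OF True z(1)] z by simp
    next
      case False
      then have "g x \<le> g z" using g z less.prems by (metis linorder_neqE_nat order.refl order_less_imp_le strict_mono_onD)
      then show False using fg z by simp
    qed
  qed
  show ?case
    using *[OF assms(1-3) less.IH] *[OF assms(2,1) assms(3)[symmetric] less.IH[symmetric]]
    by (meson linorder_neqE_nat)
qed

section \<open>The Young subgroup as the stabilizer of the block \<open>{1..l}\<close>\<close>

definition block_perms :: "nat \<Rightarrow> nat \<Rightarrow> (nat \<Rightarrow> nat) set" where
  "block_perms n l = {y. y permutes {1..n} \<and> y ` {1..l} = {1..l}}"

lemma block_perms_comp: "y \<in> block_perms n l \<Longrightarrow> z \<in> block_perms n l \<Longrightarrow> y \<circ> z \<in> block_perms n l"
  using image_comp[of y z "{1..l}"] by (simp add: block_perms_def permutes_compose)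

lemma permutes_image_Diff:
  assumes "y permutes S" "A \<subseteq> S" shows "y ` (S - A) = S - y ` A"
  using assms by (simp add: image_set_diff permutes_inj permutes_image)

lemma strict_mono_on_interval:
  assumes "\<And>i. i \<in> {a..<b} \<Longrightarrow> f i < f (i + 1)"
  shows "strict_mono_on {a..b} (f :: nat \<Rightarrow> nat)"
proof (rule strict_mono_onI)
  fix r s assume "r \<in> {a..b}" "s \<in> {a..b}" "r < s"
  then show "f r < f s"
  proof (induction s)
    case (Suc s)
    have "f s < f (Suc s)" using assms[of s] Suc.prems by auto
    then show ?case using Suc by (cases "r = s") auto
  qed simp
qed

text \<open>The image of the second block is the complement of that of the first, so an increasing
  enumeration is determined on each block.\<close>

lemma block_mono_unique:
  fixes f g :: "nat \<Rightarrow> nat"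
  assumes "f permutes {1..n}" "g permutes {1..n}" "f ` {1..l} = g ` {1..l}" "l \<le> n"
    and "strict_mono_on {1..l} f" "strict_mono_on {l + 1..n} f"
    and "strict_mono_on {1..l} g" "strict_mono_on {l + 1..n} g"
  shows "f = g"
proof (rule ext)
  fix x
  have upper: "{l + 1..n} = {1..n} - {1..l}" using assms(4) by auto
  have im: "f ` {l + 1..n} = g ` {l + 1..n}"
    unfolding upper using assms(1-4) by (simp add: permutes_image_Diff)
  consider "x \<in> {1..l}" | "x \<in> {l + 1..n}" | "x \<notin> {1..n}" by force
  then show "f x = g x"
  proof cases
    case 1
    show "f x = g x" by (rule strict_mono_on_image_unique[OF assms(5,7,3) 1])
  next
    case 2
    show "f x = g x" by (rule strict_mono_on_image_unique[OF assms(6,8) im 2])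
  next
    case 3
    then show "f x = g x" using permutes_not_in[OF assms(1)] permutes_not_in[OF assms(2)] by metis
  qed
qed

lemma transpose_adjacent_block_perms:
  assumes "1 \<le> i" "i < n" "i \<noteq> l" shows "transposition i (i + 1) \<in> block_perms n l"
proof -
  have "transposition i (i + 1) ` {1..l} = {1..l}"
    using assms by (intro transpose_image_eq) auto
  moreover have "transposition i (i + 1) permutes {1..n}"
    using assms by (intro permutes_swap_id) auto
  ultimately show ?thesis unfolding block_perms_def by blast
qed

lemma young_subgroup_subset_block_perms: "young_subgroup n l \<subseteq> block_perms n l"
proof
  fix y assume "y \<in> young_subgroup n l"
  then show "y \<in> block_perms n l"
    unfolding young_subgroup_def
  proof (induction y rule: generate.induct)
    case one
    show ?case using permutes_id[of "{1..n}"] by (simp add: block_perms_def sym_group_one id_def)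
  next
    case (incl y)
    then show ?case using transpose_adjacent_block_perms by auto
  next
    case (inv y)
    then obtain i where i: "1 \<le> i" "i < n" "i \<noteq> l" "y = transposition i (i + 1)" by blast
    have y: "y \<in> block_perms n l"
      unfolding i(4) by (rule transpose_adjacent_block_perms[OF i(1-3)])
    then have "inv\<^bsub>sym_group n\<^esub> y = inv' y"
      by (intro sym_group_inv_equality) (simp add: sym_group_carrier block_perms_def)
    then show ?case using y unfolding i(4) by simp
  next
    case (eng y z)
    then show ?case unfolding sym_group_mult by (intro block_perms_comp)
  qed
qed

text \<open>Bubble sort: a descent inside a block is removed by a generator, which lowers the
  inversion number. Without such descents \<open>y\<close> is increasing on both blocks and
  preserves them, hence is the identity.\<close>

lemma block_perms_subset_young_subgroup:
  assumes "1 \<le> l" "l \<le> n" shows "block_perms n l \<subseteq> young_subgroup n l"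
proof
  fix y assume "y \<in> block_perms n l"
  then show "y \<in> young_subgroup n l"
  proof (induction "inversion_number n y" arbitrary: y rule: less_induct)
    case (less y)
    have y: "y permutes {1..n}" and yl: "y ` {1..l} = {1..l}"
      using less.prems by (auto simp: block_perms_def)
    show ?case
    proof (cases "\<exists>i. 1 \<le> i \<and> i < n \<and> i \<noteq> l \<and> y (i + 1) < y i")
      case True
      then obtain i where i: "1 \<le> i" "i < n" "i \<noteq> l" "y (i + 1) < y i" by blast
      let ?t = "transposition i (i + 1)"
      have "inversion_number n (y \<circ> ?t) < inversion_number n y"
        using i by (intro inversion_number_transpose_less) auto
      moreover have "?t \<in> young_subgroup n l"
        unfolding young_subgroup_def using i by (intro generate.incl) auto
      moreover from this have "y \<circ> ?t \<in> block_perms n l"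
        using less.prems young_subgroup_subset_block_perms by (blast intro: block_perms_comp)
      ultimately have "(y \<circ> ?t) \<otimes>\<^bsub>sym_group n\<^esub> ?t \<in> young_subgroup n l"
        using less.hyps unfolding young_subgroup_def by (intro generate.eng) auto
      then show ?thesis by (simp add: sym_group_mult comp_assoc)
    next
      case False
      have asc: "y i < y (i + 1)" if "1 \<le> i" "i < n" "i \<noteq> l" for i
        using False that permutes_inj[OF y] by (metis injD less_irrefl linorder_neqE_nat less_add_one)
      have "strict_mono_on {1..l} y" "strict_mono_on {l + 1..n} y"
        by (rule strict_mono_on_interval; use asc assms in auto)+
      then have "y = id"
        using less.prems permutes_id[of "{1..n}"] by (intro block_mono_unique[where l = l and n = n])
          (simp_all add: block_perms_def assms(2) strict_mono_on_def)
      then have "y = \<one>\<^bsub>sym_group n\<^esub>" by (simp add: sym_group_one)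
      then show ?thesis unfolding young_subgroup_def by (simp only: generate.one)
    qed
  qed
qed

lemma young_subgroup_eq: "1 \<le> l \<Longrightarrow> l \<le> n \<Longrightarrow> young_subgroup n l = block_perms n l"
  using young_subgroup_subset_block_perms block_perms_subset_young_subgroup by blast

lemma coset_reps_unique:
  assumes "u \<in> coset_reps n l" "v \<in> coset_reps n l" "inv' u ` {1..l} = inv' v ` {1..l}" "l \<le> n"
  shows "u = v"
proof -
  have u: "u permutes {1..n}" and v: "v permutes {1..n}"
    using assms by (auto simp: coset_reps_def)
  have "inv' u = inv' v"
    using assms permutes_inv[OF u] permutes_inv[OF v]
    by (intro block_mono_unique[where l = l and n = n]) (simp_all add: coset_reps_def)
  then show ?thesis using u v by (metis permutes_inv_inv)
qed

section \<open>Factorization of a permutation through \<open>coset_reps\<close>\<close>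

lemma ex_strict_mono_enumeration:
  assumes "finite A" "card A = k"
  shows "\<exists>f. strict_mono_on {a + 1..a + k} f \<and> f ` {a + 1..a + k} = (A :: nat set)"
proof -
  let ?xs = "sorted_list_of_set A"
  let ?f = "\<lambda>i. ?xs ! (i - (a + 1))"
  have len: "length ?xs = k" using assms by simp
  have srt: "sorted_wrt (<) ?xs" by simp
  have "strict_mono_on {a + 1..a + k} ?f"
    using assms by (intro strict_mono_onI sorted_wrt_nth_less[OF srt]) auto
  moreover have "?f ` {a + 1..a + k} = A"
  proof -
    have "(\<lambda>i. i - (a + 1)) ` {a + 1..a + k} = {..<k}"
    proof (intro equalityI subsetI)
      fix x assume "x \<in> {..<k}"
      then show "x \<in> (\<lambda>i. i - (a + 1)) ` {a + 1..a + k}" by (intro image_eqI[of _ _ "x + a + 1"]) auto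
    qed auto
    then have "?f ` {a + 1..a + k} = (!) ?xs ` {..<k}" by (metis image_image)
    also have "\<dots> = set ?xs"
      using nth_image[of k ?xs] len by (simp add: lessThan_atLeast0)
    finally show ?thesis using assms by simp
  qed
  ultimately show ?thesis by blast
qed

text \<open>The positions in \<open>w\<close> of the values in each block are listed in increasing
  order. This listing \<open>u\<close> is the inverse of the representative, and
  \<open>w \<circ> u\<close> preserves the first block.\<close>

lemma coset_decomposition_exists:
  assumes w: "w permutes {1..n}" and "l \<le> n"
  shows "\<exists>y v. y \<in> block_perms n l \<and> v \<in> coset_reps n l \<and> w = y \<circ> v"
proof -
  let ?A = "inv' w ` {1..l}" and ?B = "inv' w ` {l + 1..n}"
  have winv: "inv' w permutes {1..n}" using w by (rule permutes_inv)
  have split: "{1..n} = {1..l} \<union> {l + 1..n}" using assms(2) by auto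
  have card: "card ?A = l" "card ?B = n - l"
    using permutes_inj[OF winv] by (simp_all add: card_image inj_on_subset)
  obtain f where f: "strict_mono_on {1..l} f" "f ` {1..l} = ?A"
    using ex_strict_mono_enumeration[of ?A l 0] card by auto
  obtain g where g: "strict_mono_on {l + 1..n} g" "g ` {l + 1..n} = ?B"
    using ex_strict_mono_enumeration[of ?B "n - l" l] card assms(2) by auto
  define u where "u i = (if i \<in> {1..l} then f i else if i \<in> {l + 1..n} then g i else i)" for i
  have ul: "u ` {1..l} = ?A" using f(2) by (simp add: u_def image_def)
  have ug: "u ` {l + 1..n} = ?B" using g(2) by (simp add: u_def image_def)
  have um: "strict_mono_on {1..l} u" "strict_mono_on {l + 1..n} u"
    using f(1) g(1) by (auto simp: strict_mono_on_def u_def)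
  have "u ` {1..n} = {1..n}"
    unfolding split image_Un ul ug
    by (metis image_Un permutes_image winv split)
  moreover from this have "inj_on u {1..n}" by (intro eq_card_imp_inj_on) auto
  ultimately have u: "u permutes {1..n}"
    using assms(2) by (intro bij_imp_permutes) (auto simp: bij_betw_def u_def)
  have "inv' u \<in> coset_reps n l"
    using u um by (simp add: coset_reps_def permutes_inv permutes_inv_inv)
  moreover have "w \<circ> u \<in> block_perms n l"
    using permutes_compose[OF u w] image_comp[of w u "{1..l}"] ul
      permutes_surj[OF w] by (simp add: block_perms_def image_f_inv_f)
  moreover have "w = (w \<circ> u) \<circ> inv' u"
    using permutes_inv_o[OF u] by (simp add: comp_assoc)
  ultimately show ?thesis by blast
qed

text \<open>Left multiplication by \<open>y\<close> only rearranges values inside the blocks, so the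
  positions holding values up to \<open>l\<close> are an invariant of the coset. Uniqueness of the
  factorization follows from this invariant.\<close>

lemma block_perms_inv_image:
  assumes "y \<in> block_perms n l" "v permutes {1..n}"
  shows "inv' (y \<circ> v) ` {1..l} = inv' v ` {1..l}"
proof -
  have y: "y permutes {1..n}" and "y ` {1..l} = {1..l}" using assms by (auto simp: block_perms_def)
  then have "inv' y ` {1..l} = {1..l}"
    by (metis inv_f_f image_inv_f_f permutes_inj)
  then show ?thesis
    using y assms(2) image_comp[of "inv' v" "inv' y" "{1..l}"]
    by (simp add: o_inv_distrib permutes_bij)
qed

lemma coset_decomposition_unique:
  assumes "y \<in> block_perms n l" "v \<in> coset_reps n l" "y' \<in> block_perms n l" "v' \<in> coset_reps n l"
    "y \<circ> v = y' \<circ> v'" "l \<le> n"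
  shows "y = y' \<and> v = v'"
proof -
  have vp: "v permutes {1..n}" "v' permutes {1..n}" using assms by (auto simp: coset_reps_def)
  have "v = v'"
    using assms block_perms_inv_image[OF assms(1) vp(1)] block_perms_inv_image[OF assms(3) vp(2)]
    by (intro coset_reps_unique[of v n l v']) auto
  moreover have "y = y'"
    using assms(5) \<open>v = v'\<close> vp by (metis comp_assoc comp_id permutes_inv_o(1))
  ultimately show ?thesis by simp
qed

lemma coset_decomposition_THE:
  assumes "y \<in> block_perms n l" "v \<in> coset_reps n l" "w = y \<circ> v" "1 \<le> l" "l \<le> n"
  shows "(THE (y, v). y \<in> young_subgroup n l \<and> v \<in> coset_reps n l \<and> w = y \<circ> v) = (y, v)"
proof (rule the_equality)
  show "case (y, v) of (y, v) \<Rightarrow> y \<in> young_subgroup n l \<and> v \<in> coset_reps n l \<and> w = y \<circ> v"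
    using assms by (simp add: young_subgroup_eq)
next
  fix z assume "case z of (y, v) \<Rightarrow> y \<in> young_subgroup n l \<and> v \<in> coset_reps n l \<and> w = y \<circ> v"
  then obtain y' v' where z: "z = (y', v')" "y' \<in> block_perms n l" "v' \<in> coset_reps n l" "w = y' \<circ> v'"
    using assms(4,5) by (cases z) (simp add: young_subgroup_eq)
  then show "z = (y, v)"
    using coset_decomposition_unique[OF z(2,3) assms(1,2) _ assms(5)] assms(3) by metis
qed

subsection \<open>Bruhat order\<close>

text \<open>The entries of the rank matrix of \<open>w\<close>, which can only decrease upwards in
  the Bruhat order.\<close>

definition low_count :: "nat \<Rightarrow> nat \<Rightarrow> (nat \<Rightarrow> nat) \<Rightarrow> nat" where
  "low_count l m w = card {p \<in> {1..m}. w p \<le> l}"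

text \<open>If both positions are among the first \<open>m\<close>, the transposition only permutes
  these positions. Otherwise at most position \<open>i\<close> among them changes, and it receives
  the larger value \<open>w j\<close>.\<close>

lemma low_count_transpose_le:
  assumes "1 \<le> i" "i < j" "w i < w j"
  shows "low_count l m (w \<circ> transposition i j) \<le> low_count l m w"
proof -
  let ?t = "transposition i j"
  let ?A = "{p \<in> {1..m}. (w \<circ> ?t) p \<le> l}" and ?B = "{p \<in> {1..m}. w p \<le> l}"
  show ?thesis
  proof (cases "j \<le> m")
    case True
    have "card ?A \<le> card ?B"
    proof (rule card_inj_on_le[of ?t])
      show "?t ` ?A \<subseteq> ?B"
        using assms True by (auto simp: Transposition.transpose_def split: if_splits)
    qed (auto intro: inj_on_subset[OF inj_transpose])
    then show ?thesis by (simp add: low_count_def)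
  next
    case False
    have "?A \<subseteq> ?B"
      using assms False by (auto simp: Transposition.transpose_def split: if_splits)
    then show ?thesis unfolding low_count_def by (intro card_mono) auto
  qed
qed

lemma low_count_bruhat_le:
  assumes "bruhat_le n u v" shows "low_count l m v \<le> low_count l m u"
  using assms unfolding bruhat_le_def
proof (induction v rule: rtrancl_induct)
  case (step v x)
  then obtain i j where *: "v permutes {1..n}" "i \<in> {1..n}" "j \<in> {1..n}" "x = v \<circ> transposition i j"
    "inversion_number n v < inversion_number n (v \<circ> transposition i j)" by blast
  have inj: "inj v" using * permutes_inj by blast
  have "low_count l m x \<le> low_count l m v"
  proof (cases i j rule: linorder_cases)
    case less
    then show ?thesis
      using * inj inversion_number_less_transposeD[of i n j v] low_count_transpose_le[of i j v] by auto
  next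
    case equal
    then show ?thesis using * by simp
  next
    case greater
    then show ?thesis
      using * inj inversion_number_less_transposeD[of j n i v] low_count_transpose_le[of j i v]
      by (auto simp: transpose_commute)
  qed
  then show ?case using step.IH by simp
qed simp

subsection \<open>Traces on quotients\<close>

lemma quot_coord_props:
  assumes "is_quot_basis s V W B" "x \<in> V"
  shows "quot_coord s W B x \<in> extensional B" "x - (\<Sum>b\<in>B. s (quot_coord s W B x b) b) \<in> W"
  using assms theI'[of "\<lambda>c. c \<in> extensional B \<and> x - (\<Sum>b\<in>B. s (c b) b) \<in> W"]
  unfolding is_quot_basis_def quot_coord_def by blast+

lemma quot_coord_eqI:
  assumes "is_quot_basis s V W B" "x \<in> V" "x - (\<Sum>b\<in>B. s (c b) b) \<in> W" "a \<in> B"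
  shows "quot_coord s W B x a = c a"
proof -
  \<comment> \<open>Uniqueness of coordinates holds among extensional functions, so an arbitrary
    \<open>c\<close> is first restricted to \<open>B\<close>.\<close>
  have eq: "(\<Sum>b\<in>B. s (restrict c B b) b) = (\<Sum>b\<in>B. s (c b) b)"
    by (intro sum.cong) auto
  have "restrict c B \<in> extensional B \<and> x - (\<Sum>b\<in>B. s (restrict c B b) b) \<in> W"
    using assms(3) unfolding eq by auto
  then have "quot_coord s W B x = restrict c B"
    using quot_coord_props[OF assms(1,2)] assms(1,2) unfolding is_quot_basis_def by blast
  then show ?thesis using assms(4) by simp
qed

text \<open>Linearity of \<open>L\<close> is required on \<open>V\<close> only; preserving
  \<open>W\<close>, it induces an endomorphism of the quotient. The case \<open>W = {0}\<close>
  covers a representation itself.\<close>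

locale quotient_map = vector_space s for s :: "complex \<Rightarrow> 'a \<Rightarrow> 'a::ab_group_add" +
  fixes V W :: "'a set" and L :: "'a \<Rightarrow> 'a"
  assumes V: "subspace V" and W: "subspace W" and WV: "W \<subseteq> V"
    and LV: "\<And>x. x \<in> V \<Longrightarrow> L x \<in> V" and LW: "\<And>x. x \<in> W \<Longrightarrow> L x \<in> W"
    and L_add: "\<And>x y. x \<in> V \<Longrightarrow> y \<in> V \<Longrightarrow> L (x + y) = L x + L y"
    and L_scale: "\<And>c x. x \<in> V \<Longrightarrow> L (s c x) = s c (L x)"
begin

lemma L_sum: "(\<And>b. b \<in> A \<Longrightarrow> g b \<in> V) \<Longrightarrow> L (\<Sum>b\<in>A. s (c b) (g b)) = (\<Sum>b\<in>A. s (c b) (L (g b)))"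
proof (induction A rule: infinite_finite_induct)
  case (insert x A)
  then show ?case
    by (simp add: L_add L_scale subspace_scale[OF V] subspace_sum[OF V])
next
  case empty
  show ?case using L_scale[of 0 0] subspace_0[OF V] by simp
next
  case (infinite A)
  then show ?case using L_scale[of 0 0] subspace_0[OF V] by simp
qed

context
  fixes B assumes B: "is_quot_basis s V W B"
begin

lemma quot_coord_scale_sum:
  assumes "finite A" "\<And>i. i \<in> A \<Longrightarrow> g i \<in> V" "a \<in> B"
  shows "quot_coord s W B (\<Sum>i\<in>A. s (c i) (g i)) a = (\<Sum>i\<in>A. c i * quot_coord s W B (g i) a)"
proof (rule quot_coord_eqI[OF B _ _ assms(3)])
  show "(\<Sum>i\<in>A. s (c i) (g i)) \<in> V"
    using assms by (intro subspace_sum[OF V] subspace_scale[OF V])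
  have "(\<Sum>i\<in>A. s (c i) (g i)) - (\<Sum>b\<in>B. s (\<Sum>i\<in>A. c i * quot_coord s W B (g i) b) b)
     = (\<Sum>i\<in>A. s (c i) (g i - (\<Sum>b\<in>B. s (quot_coord s W B (g i) b) b)))"
    by (simp add: scale_sum_left scale_right_diff_distrib scale_sum_right sum_subtractf
        sum.swap[of _ A B])
  also have "\<dots> \<in> W"
    using assms quot_coord_props(2)[OF B] by (intro subspace_sum[OF W] subspace_scale[OF W]) auto
  finally show "(\<Sum>i\<in>A. s (c i) (g i)) - (\<Sum>b\<in>B. s (\<Sum>i\<in>A. c i * quot_coord s W B (g i) b) b) \<in> W" .
qed

lemma quot_coord_cong:
  assumes "x \<in> V" "y \<in> V" "x - y \<in> W" "a \<in> B"
  shows "quot_coord s W B x a = quot_coord s W B y a"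
proof (rule quot_coord_eqI[OF B assms(1) _ assms(4)])
  have "x - y + (y - (\<Sum>b\<in>B. s (quot_coord s W B y b) b)) \<in> W"
    using assms quot_coord_props(2)[OF B] by (intro subspace_add[OF W]) auto
  then show "x - (\<Sum>b\<in>B. s (quot_coord s W B y b) b) \<in> W" by simp
qed

end

text \<open>Let \<open>C\<close> be the basis chosen in the definition. Expanding each basis modulo
  \<open>W\<close> in the other writes both traces as the same double sum, as in the identity of the
  traces of \<open>PQ\<close> and \<open>QP\<close>.\<close>

lemma quot_trace_basis:
  assumes B: "is_quot_basis s V W B"
  shows "quot_trace s V W L = (\<Sum>b\<in>B. quot_coord s W B (L b) b)"
proof -
  define C where "C = (SOME B. is_quot_basis s V W B)"
  have C: "is_quot_basis s V W C" unfolding C_def using B by (rule someI)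
  have fin: "finite B" "finite C" and BV: "B \<subseteq> V" and CV: "C \<subseteq> V"
    using B C by (auto simp: is_quot_basis_def)
  let ?f = "quot_coord s W B" and ?g = "quot_coord s W C"
  have diff: "L x - L y \<in> W" if "x \<in> V" "y \<in> V" "x - y \<in> W" for x y
  proof -
    have "L x = L (x - y) + L y" using L_add[of "x - y" y] that WV by auto
    then show ?thesis using LW[OF that(3)] by simp
  qed
  have 1: "?g (L c) c = (\<Sum>b\<in>B. ?f c b * ?g (L b) c)" if c: "c \<in> C" for c
  proof -
    have sumV: "(\<Sum>b\<in>B. s (?f c b) b) \<in> V"
      using BV by (intro subspace_sum[OF V] subspace_scale[OF V]) auto
    have "?g (L c) c = ?g (L (\<Sum>b\<in>B. s (?f c b) b)) c"
      using c CV BV sumV quot_coord_props(2)[OF B, of c] by (intro quot_coord_cong[OF C] LV diff) auto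
    also have "\<dots> = ?g (\<Sum>b\<in>B. s (?f c b) (L b)) c"
      using BV by (subst L_sum) auto
    also have "\<dots> = (\<Sum>b\<in>B. ?f c b * ?g (L b) c)"
      using BV c fin LV by (intro quot_coord_scale_sum[OF C]) auto
    finally show ?thesis .
  qed
  have 2: "?f (L b) b = (\<Sum>c\<in>C. ?g (L b) c * ?f c b)" if b: "b \<in> B" for b
  proof -
    have "?f (L b) b = ?f (\<Sum>c\<in>C. s (?g (L b) c) c) b"
      using b CV BV LV quot_coord_props(2)[OF C, of "L b"]
      by (intro quot_coord_cong[OF B] subspace_sum[OF V] subspace_scale[OF V]) auto
    also have "\<dots> = (\<Sum>c\<in>C. ?g (L b) c * ?f c b)"
      using CV b fin by (intro quot_coord_scale_sum[OF B]) auto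
    finally show ?thesis .
  qed
  have "quot_trace s V W L = (\<Sum>c\<in>C. ?g (L c) c)"
    by (simp add: quot_trace_def C_def Let_def)
  also have "\<dots> = (\<Sum>c\<in>C. \<Sum>b\<in>B. ?f c b * ?g (L b) c)" using 1 by simp
  also have "\<dots> = (\<Sum>b\<in>B. \<Sum>c\<in>C. ?g (L b) c * ?f c b)"
    by (subst sum.swap) (simp add: mult.commute)
  finally show ?thesis using 2 by simp
qed

text \<open>In a permuted basis the matrix is a permutation matrix, whose diagonal entry at
  \<open>i\<close> is \<open>1\<close> exactly when \<open>i\<close> is fixed.\<close>

lemma quot_trace_permuted_basis:
  assumes B: "is_quot_basis s V W (b ` A)" and inj: "inj_on b A"
    and act: "\<And>i. i \<in> A \<Longrightarrow> \<pi> i \<in> A" "\<And>i. i \<in> A \<Longrightarrow> L (b i) = b (\<pi> i)"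
  shows "quot_trace s V W L = of_nat (card {i \<in> A. \<pi> i = i})"
proof -
  have fin: "finite (b ` A)" and sub: "b ` A \<subseteq> V" using B by (auto simp: is_quot_basis_def)
  have finA: "finite A" using fin inj by (simp add: finite_image_iff)
  have coord: "quot_coord s W (b ` A) x y = (if y = x then 1 else 0)" if "x \<in> b ` A" "y \<in> b ` A" for x y
  proof (rule quot_coord_eqI[OF B _ _ that(2)])
    show "x \<in> V" using that sub by blast
    have "(\<Sum>y\<in>b ` A. s (if y = x then 1 else 0) y) = (\<Sum>y\<in>b ` A. if y = x then x else 0)"
      by (intro sum.cong) auto
    also have "\<dots> = x" using fin that by simp
    finally show "x - (\<Sum>y\<in>b ` A. s (if y = x then 1 else 0) y) \<in> W"
      using subspace_0[OF W] by simp
  qed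
  have "quot_trace s V W L = (\<Sum>i\<in>A. quot_coord s W (b ` A) (L (b i)) (b i))"
    using quot_trace_basis[OF B] inj by (simp add: sum.reindex)
  also have "\<dots> = (\<Sum>i\<in>A. if \<pi> i = i then 1 else 0)"
    using act inj by (intro sum.cong) (auto simp: coord dest: inj_onD)
  also have "\<dots> = of_nat (card {i \<in> A. \<pi> i = i})"
    using finA by (simp add: sum.If_cases Int_def)
  finally show ?thesis .
qed

end

section \<open>Subsets of fixed size as a model for the cosets of the Young subgroup\<close>

lemma sum_fun_apply: "(sum f A) x = (\<Sum>i\<in>A. f i x)"
  by (induction A rule: infinite_finite_induct) auto

lemma ex_permutes_image:
  assumes "finite S" "A \<subseteq> S" "B \<subseteq> S" "card A = card B"
  shows "\<exists>w. w permutes S \<and> w ` A = B"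
proof -
  have fin: "finite A" "finite B" "finite (S - A)" "finite (S - B)"
    using assms by (auto intro: finite_subset)
  obtain f where f: "bij_betw f A B"
    using finite_same_card_bij[OF fin(1,2) assms(4)] by blast
  have "card (S - A) = card (S - B)"
    using assms fin by (simp add: card_Diff_subset)
  then obtain g where g: "bij_betw g (S - A) (S - B)"
    using finite_same_card_bij[OF fin(3,4)] by blast
  define w where "w x = (if x \<in> A then f x else if x \<in> S then g x else x)" for x
  have wA: "bij_betw w A B"
    using f by (rule bij_betw_cong[THEN iffD1, rotated]) (simp add: w_def)
  have wB: "bij_betw w (S - A) (S - B)"
    using g by (rule bij_betw_cong[THEN iffD1, rotated]) (simp add: w_def)
  have "bij_betw w (A \<union> (S - A)) (B \<union> (S - B))"
    using wA wB by (rule bij_betw_combine) auto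
  moreover have "A \<union> (S - A) = S" "B \<union> (S - B) = S" using assms by auto
  ultimately have "bij_betw w S S" by simp
  then have "w permutes S" using assms(2) by (intro bij_imp_permutes) (auto simp: w_def)
  then show ?thesis using wA by (auto simp: bij_betw_def)
qed

definition ksubsets :: "nat \<Rightarrow> nat \<Rightarrow> nat set set" where
  "ksubsets n l = {I. I \<subseteq> {1..n} \<and> card I = l}"

lemma finite_ksubsets [simp]: "finite (ksubsets n l)"
  by (rule finite_subset[of _ "Pow {1..n}"]) (auto simp: ksubsets_def)

lemma permutes_image_ksubsets:
  assumes "v permutes {1..n}" "I \<in> ksubsets n l" shows "v ` I \<in> ksubsets n l"
proof -
  have "v ` I \<subseteq> v ` {1..n}" using assms(2) by (intro image_mono) (simp add: ksubsets_def)
  moreover have "card (v ` I) = card I"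
    using permutes_inj[OF assms(1)] by (intro card_image) (rule inj_on_subset[OF _ subset_UNIV])
  ultimately show ?thesis using assms by (simp add: ksubsets_def permutes_image)
qed

lemma permutes_image_inv_eq_iff:
  assumes "v permutes S" shows "inv' v ` X = I \<longleftrightarrow> X = v ` I"
  by (metis assms image_f_inv_f image_inv_f_f permutes_inj permutes_surj)

lemma permutes_inv_comp_iff:
  assumes "v permutes S" shows "inv' v \<circ> w permutes S \<longleftrightarrow> w permutes S"
proof
  assume "inv' v \<circ> w permutes S"
  then have "v \<circ> (inv' v \<circ> w) permutes S" by (rule permutes_compose[OF _ assms])
  then show "w permutes S" by (simp add: comp_assoc[symmetric] permutes_inv_o(1)[OF assms])
next
  assume "w permutes S"
  then show "inv' v \<circ> w permutes S" by (rule permutes_compose[OF _ permutes_inv[OF assms]])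
qed

text \<open>Stabilizers of points in one orbit are conjugate: here the orbit is that of
  \<open>{1..l}\<close> and the point is its image under \<open>u\<close>.\<close>

lemma block_perms_conjugate:
  assumes "u permutes {1..n}"
  shows "(\<lambda>y. u \<circ> y \<circ> inv' u) ` block_perms n l = {v. v permutes {1..n} \<and> v ` (u ` {1..l}) = u ` {1..l}}"
proof (intro equalityI subsetI)
  fix v assume "v \<in> (\<lambda>y. u \<circ> y \<circ> inv' u) ` block_perms n l"
  then obtain y where y: "y permutes {1..n}" "y ` {1..l} = {1..l}" "v = u \<circ> y \<circ> inv' u"
    by (auto simp: block_perms_def)
  have "v permutes {1..n}"
    unfolding y(3) using assms y(1) by (intro permutes_compose permutes_inv)
  moreover have "v ` (u ` {1..l}) = u ` {1..l}"
    unfolding y(3) image_comp[symmetric] image_inv_f_f[OF permutes_inj[OF assms]] y(2) ..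
  ultimately show "v \<in> {v. v permutes {1..n} \<and> v ` (u ` {1..l}) = u ` {1..l}}" by simp
next
  fix v assume "v \<in> {v. v permutes {1..n} \<and> v ` (u ` {1..l}) = u ` {1..l}}"
  then have v: "v permutes {1..n}" "v ` (u ` {1..l}) = u ` {1..l}" by auto
  have "inv' u \<circ> v \<circ> u permutes {1..n}"
    using assms v(1) by (intro permutes_compose permutes_inv)
  moreover have "(inv' u \<circ> v \<circ> u) ` {1..l} = {1..l}"
    unfolding image_comp[symmetric] v(2) image_inv_f_f[OF permutes_inj[OF assms]] ..
  ultimately have "inv' u \<circ> v \<circ> u \<in> block_perms n l" by (simp add: block_perms_def)
  moreover have "v = u \<circ> (inv' u \<circ> v \<circ> u) \<circ> inv' u"
    using permutes_inverses(1)[OF assms] by (auto simp: fun_eq_iff)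
  ultimately show "v \<in> (\<lambda>y. u \<circ> y \<circ> inv' u) ` block_perms n l" by blast
qed

subsection \<open>The induced representation and tabloids\<close>

text \<open>A left coset of \<open>block_perms n l\<close> consists of all \<open>w\<close> with the
  same image \<open>I\<close> of \<open>{1..l}\<close>, so cosets are labelled by subsets.\<close>

definition coset_indicator :: "nat \<Rightarrow> nat \<Rightarrow> nat set \<Rightarrow> (nat \<Rightarrow> nat) \<Rightarrow> complex" where
  "coset_indicator n l I w = (if w permutes {1..n} \<and> w ` {1..l} = I then 1 else 0)"

definition coset_rep :: "nat \<Rightarrow> nat \<Rightarrow> nat set \<Rightarrow> nat \<Rightarrow> nat" where
  "coset_rep n l I = (SOME w. w permutes {1..n} \<and> w ` {1..l} = I)"

lemma vector_space_fscale: "vector_space fscale"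
  by unfold_locales (auto simp: fscale_def fun_eq_iff algebra_simps)

context
  fixes n l :: nat assumes l: "l \<le> n"
begin

lemma coset_rep:
  assumes "I \<in> ksubsets n l"
  shows "coset_rep n l I permutes {1..n}" "coset_rep n l I ` {1..l} = I"
proof -
  have "\<exists>w. w permutes {1..n} \<and> w ` {1..l} = I"
    using assms l by (intro ex_permutes_image) (auto simp: ksubsets_def)
  then have "coset_rep n l I permutes {1..n} \<and> coset_rep n l I ` {1..l} = I"
    unfolding coset_rep_def by (rule someI_ex)
  then show "coset_rep n l I permutes {1..n}" "coset_rep n l I ` {1..l} = I" by auto
qed

lemma image_in_ksubsets: "w permutes {1..n} \<Longrightarrow> w ` {1..l} \<in> ksubsets n l"
  using l by (intro permutes_image_ksubsets) (auto simp: ksubsets_def)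

text \<open>Two permutations with the same image of \<open>{1..l}\<close> differ by the right factor
  \<open>inv' w \<circ> w'\<close>, which preserves this block.\<close>

lemma ind_trivial_fibre:
  assumes x: "x \<in> ind_trivial n (block_perms n l)" and w: "w permutes {1..n}" "w' permutes {1..n}"
    and im: "w ` {1..l} = w' ` {1..l}"
  shows "x w = x w'"
proof -
  have "inv' w \<circ> w' permutes {1..n}" using w by (intro permutes_compose permutes_inv)
  moreover have "(inv' w \<circ> w') ` {1..l} = {1..l}"
    unfolding image_comp[symmetric] im[symmetric] by (rule image_inv_f_f[OF permutes_inj[OF w(1)]])
  ultimately have "inv' w \<circ> w' \<in> block_perms n l" by (simp add: block_perms_def)
  then have "x (w \<circ> (inv' w \<circ> w')) = x w" using x w unfolding ind_trivial_def by blast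
  moreover have "w \<circ> (inv' w \<circ> w') = w'"
    using permutes_inverses(1)[OF w(1)] by (auto simp: fun_eq_iff)
  ultimately show ?thesis by simp
qed

lemma ind_trivial_coset_rep:
  assumes "x \<in> ind_trivial n (block_perms n l)" "w permutes {1..n}"
  shows "x w = x (coset_rep n l (w ` {1..l}))"
  using coset_rep[OF image_in_ksubsets[OF assms(2)]] assms(2)
  by (intro ind_trivial_fibre[OF assms]) auto

lemma ind_trivialI:
  assumes "\<And>w. \<not> w permutes {1..n} \<Longrightarrow> x w = 0"
    and "\<And>w. w permutes {1..n} \<Longrightarrow> x w = g (w ` {1..l})"
  shows "x \<in> ind_trivial n (block_perms n l)"
  unfolding ind_trivial_def
proof (intro CollectI conjI allI impI ballI)
  fix w y assume w: "w permutes {1..n}" and "y \<in> block_perms n l"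
  then have y: "y permutes {1..n}" "y ` {1..l} = {1..l}" by (auto simp: block_perms_def)
  have "x (w \<circ> y) = g ((w \<circ> y) ` {1..l})" by (rule assms(2)[OF permutes_compose[OF y(1) w]])
  also have "(w \<circ> y) ` {1..l} = w ` {1..l}" unfolding image_comp[symmetric] y(2) ..
  finally show "x (w \<circ> y) = x w" unfolding assms(2)[OF w] .
qed (rule assms(1))

lemma inj_coset_indicator: "inj_on (coset_indicator n l) (ksubsets n l)"
proof (rule inj_onI)
  fix I J assume I: "I \<in> ksubsets n l" and eq: "coset_indicator n l I = coset_indicator n l J"
  have "coset_indicator n l I (coset_rep n l I) = 1"
    using coset_rep[OF I] by (simp add: coset_indicator_def)
  then have "coset_indicator n l J (coset_rep n l I) = 1" by (simp only: eq)
  then show "I = J"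
    using coset_rep[OF I] by (simp add: coset_indicator_def split: if_splits)
qed

lemma sum_coset_indicator:
  "(\<Sum>b\<in>coset_indicator n l ` ksubsets n l. fscale (c b) b) w =
     (if w permutes {1..n} then c (coset_indicator n l (w ` {1..l})) else 0)"
proof -
  have "(\<Sum>b\<in>coset_indicator n l ` ksubsets n l. fscale (c b) b) w =
      (\<Sum>I\<in>ksubsets n l. c (coset_indicator n l I) * coset_indicator n l I w)"
    by (simp add: sum_fun_apply sum.reindex[OF inj_coset_indicator] fscale_def)
  also have "\<dots> = (\<Sum>I\<in>ksubsets n l. if I = w ` {1..l} then
      (if w permutes {1..n} then c (coset_indicator n l (w ` {1..l})) else 0) else 0)"
    by (intro sum.cong) (auto simp: coset_indicator_def)
  finally show ?thesis
    using image_in_ksubsets[of w] by auto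
qed

lemma subspace_ind_trivial: "module.subspace fscale (ind_trivial n H)"
proof -
  interpret vector_space fscale by (rule vector_space_fscale)
  show ?thesis unfolding subspace_def by (auto simp: ind_trivial_def fscale_def)
qed

text \<open>The coset indicators form a basis that left translation permutes as it permutes the
  subsets labelling them, so the trace counts fixed subsets.\<close>

lemma ind_character_eq:
  assumes v: "v permutes {1..n}"
  shows "ind_character n (block_perms n l) v = of_nat (card {I \<in> ksubsets n l. v ` I = I})"
proof -
  let ?V = "ind_trivial n (block_perms n l)" and ?e = "coset_indicator n l"
  have lt: "left_translate v x \<in> ?V" if x: "x \<in> ?V" for x
  proof (rule ind_trivialI[where g = "\<lambda>I. x (coset_rep n l (inv' v ` I))"])
    fix w assume "\<not> w permutes {1..n}"
    then show "left_translate v x w = 0"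
      using x permutes_inv_comp_iff[OF v] by (auto simp: left_translate_def ind_trivial_def)
  next
    fix w assume "w permutes {1..n}"
    then show "left_translate v x w = x (coset_rep n l (inv' v ` (w ` {1..l})))"
      using ind_trivial_coset_rep[OF x] permutes_inv_comp_iff[OF v]
      unfolding left_translate_def image_comp by blast
  qed
  interpret vector_space fscale by (rule vector_space_fscale)
  interpret Q: quotient_map fscale ?V "{0}" "left_translate v"
  proof (unfold_locales)
    show "subspace ?V" by (rule subspace_ind_trivial)
    show "{0} \<subseteq> ?V" using subspace_0[OF subspace_ind_trivial] by simp
    show "left_translate v x \<in> ?V" if "x \<in> ?V" for x using that by (rule lt)
  qed (auto simp: left_translate_def fscale_def fun_eq_iff)
  have basis: "is_quot_basis fscale ?V {0} (?e ` ksubsets n l)"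
    unfolding is_quot_basis_def
  proof (intro conjI ballI)
    show "?e ` ksubsets n l \<subseteq> ?V"
    proof (rule image_subsetI)
      fix I show "?e I \<in> ?V"
        by (rule ind_trivialI[where g = "\<lambda>J. of_bool (J = I)"]) (simp_all add: coset_indicator_def)
    qed
  next
    fix x assume x: "x \<in> ?V"
    \<comment> \<open>Modulo \<open>{0}\<close> this is an equality of functions, and both sides are
      determined by their values at the coset representatives.\<close>
    have iff: "x - (\<Sum>b\<in>?e ` ksubsets n l. fscale (c b) b) \<in> {0} \<longleftrightarrow>
        (\<forall>I\<in>ksubsets n l. c (?e I) = x (coset_rep n l I))" for c
    proof
      assume "x - (\<Sum>b\<in>?e ` ksubsets n l. fscale (c b) b) \<in> {0}"
      then have eq: "x = (\<Sum>b\<in>?e ` ksubsets n l. fscale (c b) b)" by simp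
      show "\<forall>I\<in>ksubsets n l. c (?e I) = x (coset_rep n l I)"
      proof
        fix I assume "I \<in> ksubsets n l"
        then show "c (?e I) = x (coset_rep n l I)"
          using fun_cong[OF eq, of "coset_rep n l I"] coset_rep[of I]
          unfolding sum_coset_indicator by simp
      qed
    next
      assume c: "\<forall>I\<in>ksubsets n l. c (?e I) = x (coset_rep n l I)"
      have "x w = (\<Sum>b\<in>?e ` ksubsets n l. fscale (c b) b) w" for w
        unfolding sum_coset_indicator
        using c x image_in_ksubsets[of w] ind_trivial_coset_rep[OF x, of w] by (auto simp: ind_trivial_def)
      then have "x = (\<Sum>b\<in>?e ` ksubsets n l. fscale (c b) b)" by (rule ext)
      then show "x - (\<Sum>b\<in>?e ` ksubsets n l. fscale (c b) b) \<in> {0}" by simp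
    qed
    \<comment> \<open>Coordinates are indexed by basis vectors, not by subsets;
      \<open>inv_into\<close> recovers the subset and \<open>restrict\<close> makes the function
      extensional.\<close>
    define c0 where "c0 = restrict (\<lambda>b. x (coset_rep n l (inv_into (ksubsets n l) ?e b))) (?e ` ksubsets n l)"
    have c0: "c0 (?e I) = x (coset_rep n l I)" if "I \<in> ksubsets n l" for I
      using that by (simp add: c0_def inv_into_f_f[OF inj_coset_indicator])
    show "\<exists>!c. c \<in> extensional (?e ` ksubsets n l) \<and> x - (\<Sum>b\<in>?e ` ksubsets n l. fscale (c b) b) \<in> {0}"
      unfolding iff
    proof (rule ex1I[of _ c0])
      show "c0 \<in> extensional (?e ` ksubsets n l) \<and> (\<forall>I\<in>ksubsets n l. c0 (?e I) = x (coset_rep n l I))"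
        using c0 unfolding c0_def by simp
    next
      fix c assume c: "c \<in> extensional (?e ` ksubsets n l) \<and> (\<forall>I\<in>ksubsets n l. c (?e I) = x (coset_rep n l I))"
      show "c = c0"
      proof (rule extensionalityI)
        show "c \<in> extensional (?e ` ksubsets n l)" using c by blast
        show "c0 \<in> extensional (?e ` ksubsets n l)" by (simp add: c0_def)
        show "c b = c0 b" if "b \<in> ?e ` ksubsets n l" for b using that c c0 by auto
      qed
    qed
  qed simp
  show ?thesis unfolding ind_character_def
  proof (rule Q.quot_trace_permuted_basis[OF basis inj_coset_indicator])
    show "v ` I \<in> ksubsets n l" if "I \<in> ksubsets n l" for I
      using that by (rule permutes_image_ksubsets[OF v])
    show "left_translate v (?e I) = ?e (v ` I)" for I
      unfolding left_translate_def coset_indicator_def fun_eq_iff permutes_inv_comp_iff[OF v]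
        image_comp[symmetric] permutes_image_inv_eq_iff[OF v] by simp
  qed
qed

end

text \<open>Since \<open>Par\<close> puts the larger part first, \<open>I\<close> is the first or
  the second row according to its size; with equal parts it is the first.\<close>

definition tabloid_of :: "nat \<Rightarrow> nat \<Rightarrow> nat set \<Rightarrow> nat set list" where
  "tabloid_of n l I = (if n - l \<le> l then [I, {1..n} - I] else [{1..n} - I, I])"

definition tabloid_row :: "nat \<Rightarrow> nat \<Rightarrow> nat set list \<Rightarrow> nat set" where
  "tabloid_row n l T = T ! (if n - l \<le> l then 0 else 1)"

lemma tabloid_row_of [simp]: "tabloid_row n l (tabloid_of n l I) = I"
  by (simp add: tabloid_row_def tabloid_of_def)

context
  fixes n l1 l2 :: nat assumes n: "l1 + l2 = n"
begin

lemma tabloids_Par: "tabloids n (Par [l1, l2]) = tabloid_of n l1 ` ksubsets n l1"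
proof -
  have two: "(\<forall>i<length [a, b]. P i) \<longleftrightarrow> P 0 \<and> P 1" for a b :: nat and P :: "nat \<Rightarrow> bool"
    by (auto simp: less_Suc_eq)
  have tab: "tabloids n [a, b] = {T. \<exists>A B. T = [A, B] \<and> card A = a \<and> card B = b \<and> A \<inter> B = {} \<and> A \<union> B = {1..n}}"
    for a b
  proof (intro equalityI subsetI)
    fix T assume T: "T \<in> tabloids n [a, b]"
    then have "length T = Suc (Suc 0)" by (simp add: tabloids_def)
    then obtain A B where AB: "T = [A, B]" by (auto simp: length_Suc_conv)
    show "T \<in> {T. \<exists>A B. T = [A, B] \<and> card A = a \<and> card B = b \<and> A \<inter> B = {} \<and> A \<union> B = {1..n}}"
      using T unfolding AB tabloids_def two by auto
  next
    fix T assume "T \<in> {T. \<exists>A B. T = [A, B] \<and> card A = a \<and> card B = b \<and> A \<inter> B = {} \<and> A \<union> B = {1..n}}"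
    then show "T \<in> tabloids n [a, b]" unfolding tabloids_def two by auto
  qed
  have compl: "B = {1..n} - A \<and> card A = l1 \<and> A \<subseteq> {1..n}"
    if "A \<inter> B = {}" "A \<union> B = {1..n}" "card A = l1" for A B :: "nat set" using that by auto
  have card_compl: "card ({1..n} - I) = l2" if "I \<in> ksubsets n l1" for I
    using that n finite_subset[of I "{1..n}"] by (simp add: ksubsets_def card_Diff_subset)
  show ?thesis
  proof (cases "n - l1 \<le> l1")
    case True
    then have "Par [l1, l2] = [l1, l2]" using n by (auto simp: Par_def)
    moreover have "tabloids n [l1, l2] = (\<lambda>I. [I, {1..n} - I]) ` ksubsets n l1"
    proof (intro equalityI subsetI)
      fix T assume "T \<in> tabloids n [l1, l2]"
      then obtain A B where "T = [A, B]" "card A = l1" "A \<inter> B = {}" "A \<union> B = {1..n}"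
        unfolding tab by blast
      then show "T \<in> (\<lambda>I. [I, {1..n} - I]) ` ksubsets n l1"
        by (intro image_eqI[of _ _ A]) (auto simp: ksubsets_def)
    next
      fix T assume "T \<in> (\<lambda>I. [I, {1..n} - I]) ` ksubsets n l1"
      then show "T \<in> tabloids n [l1, l2]" unfolding tab using card_compl by (auto simp: ksubsets_def)
    qed
    ultimately show ?thesis using True unfolding tabloid_of_def by simp
  next
    case False
    then have "Par [l1, l2] = [l2, l1]" using n by (auto simp: Par_def)
    moreover have "tabloids n [l2, l1] = (\<lambda>I. [{1..n} - I, I]) ` ksubsets n l1"
    proof (intro equalityI subsetI)
      fix T assume "T \<in> tabloids n [l2, l1]"
      then obtain A B where "T = [B, A]" "card A = l1" "B \<inter> A = {}" "B \<union> A = {1..n}"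
        unfolding tab by blast
      then show "T \<in> (\<lambda>I. [{1..n} - I, I]) ` ksubsets n l1"
        by (intro image_eqI[of _ _ A]) (auto simp: ksubsets_def)
    next
      fix T assume "T \<in> (\<lambda>I. [{1..n} - I, I]) ` ksubsets n l1"
      then show "T \<in> tabloids n [l2, l1]" unfolding tab using card_compl by (auto simp: ksubsets_def)
    qed
    ultimately show ?thesis using False unfolding tabloid_of_def by simp
  qed
qed

lemma map_image_tabloid_of:
  assumes "v permutes {1..n}" "I \<in> ksubsets n l1"
  shows "map ((`) v) (tabloid_of n l1 I) = tabloid_of n l1 (v ` I)"
  using permutes_image_Diff[OF assms(1), of I] assms(2) by (simp add: tabloid_of_def ksubsets_def)

lemma map_image_tabloids_iff:
  assumes v: "v permutes {1..n}"
  shows "map ((`) (inv' v)) T \<in> tabloids n (Par [l1, l2]) \<longleftrightarrow> T \<in> tabloids n (Par [l1, l2])"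
proof -
  have mem: "map ((`) u) T \<in> tabloids n (Par [l1, l2])"
    if "T \<in> tabloids n (Par [l1, l2])" "u permutes {1..n}" for u T
    using that map_image_tabloid_of[OF that(2)] permutes_image_ksubsets[OF that(2)]
    unfolding tabloids_Par by auto
  have "map ((`) v) (map ((`) (inv' v)) T) = T"
    by (simp add: image_f_inv_f[OF permutes_surj[OF v]] comp_def)
  then show ?thesis using mem v permutes_inv[OF v] by metis
qed

lemma rep_iso_ind_trivial_perm_module:
  "rep_iso n (ind_trivial n (block_perms n l1)) left_translate (perm_module n (Par [l1, l2])) tabloid_act"
proof -
  let ?V = "ind_trivial n (block_perms n l1)" and ?M = "perm_module n (Par [l1, l2])"
    and ?T = "tabloids n (Par [l1, l2])"
  have l: "l1 \<le> n" using n by simp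
  \<comment> \<open>A function constant on cosets is read as a function of subsets, and a subset as
    a row of a tabloid; \<open>\<Psi>\<close> below is the inverse.\<close>
  define \<Phi> :: "((nat \<Rightarrow> nat) \<Rightarrow> complex) \<Rightarrow> nat set list \<Rightarrow> complex" where
    "\<Phi> x T = (if T \<in> ?T then x (coset_rep n l1 (tabloid_row n l1 T)) else 0)" for x T
  define \<Psi> :: "(nat set list \<Rightarrow> complex) \<Rightarrow> (nat \<Rightarrow> nat) \<Rightarrow> complex" where
    "\<Psi> f w = (if w permutes {1..n} then f (tabloid_of n l1 (w ` {1..l1})) else 0)" for f w
  have \<Phi>_of: "\<Phi> x (tabloid_of n l1 I) = x (coset_rep n l1 I)" if "I \<in> ksubsets n l1" for x I
    using that by (simp add: \<Phi>_def tabloids_Par)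
  have "bij_betw \<Phi> ?V ?M"
  proof (rule bij_betw_byWitness[of _ \<Psi>])
    show "\<forall>x\<in>?V. \<Psi> (\<Phi> x) = x"
    proof
      fix x assume x: "x \<in> ?V"
      have "\<Psi> (\<Phi> x) w = x w" for w
        using \<Phi>_of[OF image_in_ksubsets[OF l]] ind_trivial_coset_rep[OF l x, of w] x
        by (auto simp: \<Psi>_def ind_trivial_def)
      then show "\<Psi> (\<Phi> x) = x" by (rule ext)
    qed
    show "\<forall>f\<in>?M. \<Phi> (\<Psi> f) = f"
    proof
      fix f assume f: "f \<in> ?M"
      have "\<Phi> (\<Psi> f) T = f T" for T
      proof (cases "T \<in> ?T")
        case True
        then obtain I where I: "I \<in> ksubsets n l1" "T = tabloid_of n l1 I" unfolding tabloids_Par by blast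
        show ?thesis
          unfolding I(2) \<Phi>_of[OF I(1)] \<Psi>_def using coset_rep[OF l I(1)] by simp
      next
        case False
        then show ?thesis using f by (simp add: \<Phi>_def perm_module_def)
      qed
      then show "\<Phi> (\<Psi> f) = f" by (rule ext)
    qed
    show "\<Phi> ` ?V \<subseteq> ?M" by (auto simp: \<Phi>_def perm_module_def)
    show "\<Psi> ` ?M \<subseteq> ?V"
    proof (rule image_subsetI)
      fix f show "\<Psi> f \<in> ?V"
        by (rule ind_trivialI[where g = "\<lambda>I. f (tabloid_of n l1 I)", OF l]) (simp_all add: \<Psi>_def)
    qed
  qed
  moreover have "\<Phi> (left_translate v x) = tabloid_act v (\<Phi> x)" if v: "v permutes {1..n}" and x: "x \<in> ?V" for v x
  proof (rule ext)
    fix T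
    show "\<Phi> (left_translate v x) T = tabloid_act v (\<Phi> x) T"
    proof (cases "T \<in> ?T")
      case True
      then obtain I where I: "I \<in> ksubsets n l1" "T = tabloid_of n l1 I" unfolding tabloids_Par by blast
      note inv = permutes_inv[OF v]
      have "\<Phi> (left_translate v x) T = x (inv' v \<circ> coset_rep n l1 I)"
        unfolding I(2) \<Phi>_of[OF I(1)] left_translate_def ..
      \<comment> \<open>\<open>inv' v \<circ> coset_rep n l1 I\<close> is generally not the chosen
        representative of its coset, but \<open>x\<close> has the same value at both.\<close>
      also have "\<dots> = x (coset_rep n l1 ((inv' v \<circ> coset_rep n l1 I) ` {1..l1}))"
        by (rule ind_trivial_coset_rep[OF l x permutes_compose[OF coset_rep(1)[OF l I(1)] inv]])
      also have "(inv' v \<circ> coset_rep n l1 I) ` {1..l1} = inv' v ` I"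
        unfolding image_comp[symmetric] coset_rep(2)[OF l I(1)] ..
      also have "x (coset_rep n l1 (inv' v ` I)) = tabloid_act v (\<Phi> x) T"
        unfolding tabloid_act_def I(2) map_image_tabloid_of[OF inv I(1)]
          \<Phi>_of[OF permutes_image_ksubsets[OF inv I(1)]] ..
      finally show ?thesis .
    next
      case False
      then show ?thesis
        using map_image_tabloids_iff[OF v, of T] by (simp add: \<Phi>_def tabloid_act_def)
    qed
  qed
  moreover have "\<Phi> (x + y) = \<Phi> x + \<Phi> y" "\<Phi> (fscale c x) = fscale c (\<Phi> x)" for x y c
    by (auto simp: \<Phi>_def fscale_def)
  ultimately show ?thesis unfolding rep_iso_def by blast
qed

end

subsection \<open>Divisibility conditions and the translates of the class\<close>

text \<open>Membership in \<open>polyring n\<close> is part of the relation because the quotient for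
  a product of congruences involves the polynomials themselves.\<close>

definition cong_mod :: "nat \<Rightarrow> cpoly \<Rightarrow> cpoly \<Rightarrow> cpoly \<Rightarrow> bool" where
  "cong_mod n d p q \<longleftrightarrow> p \<in> polyring n \<and> q \<in> polyring n \<and> (\<exists>r\<in>polyring n. p - q = d * r)"

lemma cong_mod_refl: "p \<in> polyring n \<Longrightarrow> cong_mod n d p p"
  by (auto simp: cong_mod_def intro!: bexI[of _ 0])

lemma cong_mod_diff:
  assumes "cong_mod n d p q" "cong_mod n d p' q'" shows "cong_mod n d (p - p') (q - q')"
proof -
  obtain r r' where "r \<in> polyring n" "r' \<in> polyring n" "p - q = d * r" "p' - q' = d * r'"
    using assms by (auto simp: cong_mod_def)
  then have "p - p' - (q - q') = d * (r - r')" "r - r' \<in> polyring n"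
    by (simp_all add: algebra_simps)
  then show ?thesis using assms unfolding cong_mod_def by (auto intro!: polyring_diff)
qed

lemma cong_mod_mult:
  assumes "cong_mod n d p q" "cong_mod n d p' q'" shows "cong_mod n d (p * p') (q * q')"
proof -
  obtain r r' where r: "r \<in> polyring n" "r' \<in> polyring n" "p - q = d * r" "p' - q' = d * r'"
    and mem: "p \<in> polyring n" "q \<in> polyring n" "p' \<in> polyring n" "q' \<in> polyring n"
    using assms by (auto simp: cong_mod_def)
  have "p * p' - q * q' = p * (p' - q') + (p - q) * q'" by (simp add: algebra_simps)
  also have "\<dots> = d * (p * r' + r * q')" unfolding r by (simp add: algebra_simps)
  finally show ?thesis using mem r unfolding cong_mod_def by (auto intro!: polyring_mult polyring_add)
qed

lemma cong_mod_prod: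
  "(\<And>i. i \<in> A \<Longrightarrow> cong_mod n d (f i) (g i)) \<Longrightarrow> cong_mod n d (prod f A) (prod g A)"
  by (induction A rule: infinite_finite_induct) (auto intro: cong_mod_mult cong_mod_refl)

text \<open>The transposition changes the variable by \<open>0\<close> or by plus or minus the
  modulus.\<close>

lemma cong_mod_tvar_transpose:
  assumes "w permutes {1..n}" "i \<in> {1..n}" "j \<in> {1..n}" "a \<in> {1..n}"
  shows "cong_mod n (tvar (w i) - tvar (w j)) (tvar (w a)) (tvar (w (transposition i j a)))"
proof -
  have mem: "tvar (w b) \<in> polyring n" if "b \<in> {1..n}" for b
    using permutes_in_image[OF assms(1)] that by (intro polyring_tvar) blast
  note ij = mem[OF assms(2)] mem[OF assms(3)]
  consider "a = i" | "a = j" | "a \<noteq> i" "a \<noteq> j" by blast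
  then show ?thesis
  proof cases
    case 1
    show ?thesis unfolding 1 cong_mod_def using ij by (auto intro!: bexI[of _ 1])
  next
    case 2
    show ?thesis unfolding 2 cong_mod_def using ij by (auto intro!: bexI[of _ "- 1"])
  next
    case 3
    then show ?thesis using cong_mod_refl[OF mem[OF assms(4)]] by simp
  qed
qed

lemma dvd_prod_polyring:
  assumes "finite A" "a \<in> A" "\<And>b. b \<in> A \<Longrightarrow> f b \<in> polyring n"
  shows "\<exists>q\<in>polyring n. prod f A = f a * q"
proof (rule bexI[of _ "prod f (A - {a})"])
  show "prod f (A - {a}) \<in> polyring n" by (rule polyring_prod) (use assms in auto)
qed (use assms in \<open>simp add: prod.remove\<close>)

section \<open>The representative \<open>vk\<close> and the representatives above it\<close>

locale two_part_class =
  fixes n l1 l2 :: nat and h :: "nat \<Rightarrow> nat"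
  assumes hess: "hessenberg_fun n h"
    and l1: "l1 \<ge> 1" and n_eq: "l1 + l2 = n"
    and h1: "h 1 < l2"
    and hl2: "l1 > 1 \<Longrightarrow> h (l2 + 1) = n"
begin

lemma l2: "l2 \<ge> 2"
proof -
  have "1 \<in> {1..n}" using l1 n_eq by simp
  then have "1 \<le> h 1" using hess unfolding hessenberg_fun_def by blast
  then show ?thesis using h1 by simp
qed

definition vk :: "nat \<Rightarrow> nat" where "vk = vperm n l1 (l2 - 1)"

text \<open>The inverse of \<open>vk\<close> in closed form, read off from the word
  \<open>[l2, l2 + 2, ..., n, 1, ..., l2 - 1, l2 + 1]\<close>.\<close>

definition ivk :: "nat \<Rightarrow> nat" where
  "ivk j = (if j = 1 then l2 else if j \<in> {2..l1} then j + l2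
     else if j \<in> {l1 + 1..n - 1} then j - l1 else if j = n then l2 + 1 else j)"

definition A1 :: "nat set" where "A1 = {l2 + 1..n}"
definition A2 :: "nat set" where "A2 = insert l2 {l2 + 2..n}"

lemma vk_apply:
  "vk i = (if i \<in> {1..l2 - 1} then l1 + i else if i = l2 then 1 else if i = l2 + 1 then n
     else if i \<in> {l2 + 2..n} then i - l2 else i)"
proof -
  let ?xs = "[l1 + 1..<n] @ [1] @ [n] @ [2..<l1 + 1]"
  \<comment> \<open>For \<open>k = l2 - 1\<close> the third segment of the word shrinks to the
    single entry \<open>n\<close>.\<close>
  have k: "l1 + (l2 - 1) + 1 = n" using l2 n_eq by simp
  have vk: "vk i = one_line ?xs i"
    unfolding vk_def vperm_def k by simp
  have len: "length ?xs = n" using l1 n_eq l2 unfolding length_append length_upt by simp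
  have nth: "vk i = ?xs ! (i - 1)" if "i \<in> {1..n}"
    using that unfolding vk one_line_def len by (simp only: if_True)
  consider "i \<in> {1..l2 - 1}" | "i = l2" | "i = l2 + 1" | "i \<in> {l2 + 2..n}" | "i \<notin> {1..n}"
    by fastforce
  then show ?thesis
  proof cases
    case 1
    then have i: "i \<in> {1..n}" "i - 1 < length [l1 + 1..<n]" using n_eq by auto
    have "vk i = [l1 + 1..<n] ! (i - 1)"
      unfolding nth[OF i(1)] nth_append using i(2) by (simp only: if_True)
    also have "\<dots> = l1 + i" using 1 n_eq by (subst nth_upt) auto
    finally show ?thesis using 1 by simp
  next
    case 2
    then have i: "i \<in> {1..n}" "i - 1 = length [l1 + 1..<n]" using n_eq l2 by auto
    have "vk i = 1"
      unfolding nth[OF i(1)] i(2) append_Cons by (rule nth_append_length)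
    then show ?thesis using 2 l2 by auto
  next
    case 3
    then have i: "i \<in> {1..n}" "i - 1 = length ([l1 + 1..<n] @ [1])" using n_eq l1 l2 by auto
    have "(([l1 + 1..<n] @ [1]) @ n # [2..<l1 + 1]) ! (i - 1) = n"
      unfolding i(2) by (rule nth_append_length)
    then have "vk i = n" unfolding nth[OF i(1)] append_assoc append_Cons append_Nil .
    then show ?thesis using 3 l2 by auto
  next
    case 4
    then have i: "i \<in> {1..n}" by auto
    have len': "length ([l1 + 1..<n] @ [1, n]) = l2 + 1" using n_eq l2 by simp
    have "(([l1 + 1..<n] @ [1, n]) @ [2..<l1 + 1]) ! (i - 1) = [2..<l1 + 1] ! (i - 1 - (l2 + 1))"
      unfolding nth_append[of "[l1 + 1..<n] @ [1, n]"] len' using 4 by auto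
    then have "vk i = [2..<l1 + 1] ! (i - 1 - (l2 + 1))"
      unfolding nth[OF i] append_assoc append_Cons append_Nil .
    also have "\<dots> = i - l2" using 4 n_eq by (subst nth_upt) auto
    finally show ?thesis using 4 by auto
  next
    case 5
    then have "vk i = i" unfolding vk one_line_def len by (simp only: if_False)
    then show ?thesis using 5 n_eq l1 l2 by auto
  qed
qed

lemma n_ge: "n \<ge> 3" "l1 < n" "l2 < n"
  using l1 l2 n_eq by linarith+

lemma vk_low: "1 \<le> i \<Longrightarrow> i < l2 \<Longrightarrow> vk i = l1 + i"
  unfolding vk_apply by auto

lemma vk_l2: "vk l2 = 1"
  unfolding vk_apply using l2 by simp

lemma vk_Suc_l2: "vk (l2 + 1) = n"
  unfolding vk_apply by auto

lemma vk_high: "l2 + 2 \<le> i \<Longrightarrow> i \<le> n \<Longrightarrow> vk i = i - l2"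
  unfolding vk_apply by simp

lemma vk_out: "i \<notin> {1..n} \<Longrightarrow> vk i = i"
  unfolding vk_apply using n_ge l2 n_eq l1 by (simp only: if_False atLeastAtMost_iff) auto

lemma ivk_1: "ivk 1 = l2"
  unfolding ivk_def by simp

lemma ivk_low: "2 \<le> j \<Longrightarrow> j \<le> l1 \<Longrightarrow> ivk j = j + l2"
  unfolding ivk_def by simp

lemma ivk_high: "l1 < j \<Longrightarrow> j < n \<Longrightarrow> ivk j = j - l1"
  unfolding ivk_def using l1 by simp

lemma ivk_n: "ivk n = l2 + 1"
  unfolding ivk_def using n_ge by simp

lemma ivk_out: "j \<notin> {1..n} \<Longrightarrow> ivk j = j"
  unfolding ivk_def using n_ge l1 by auto

lemma position_cases:
  obtains "1 \<le> i" "i < l2" | "i = l2" | "i = l2 + 1" | "l2 + 2 \<le> i" "i \<le> n" | "i \<notin> {1..n}"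
proof -
  have "(1 \<le> i \<and> i < l2) \<or> i = l2 \<or> i = l2 + 1 \<or> (l2 + 2 \<le> i \<and> i \<le> n) \<or> \<not> (1 \<le> i \<and> i \<le> n)"
    by linarith
  then show ?thesis using that by force
qed

lemma value_cases:
  obtains "j = 1" | "2 \<le> j" "j \<le> l1" | "l1 < j" "j < n" | "j = n" | "j \<notin> {1..n}"
proof -
  have "j = 1 \<or> (2 \<le> j \<and> j \<le> l1) \<or> (l1 < j \<and> j < n) \<or> j = n \<or> \<not> (1 \<le> j \<and> j \<le> n)"
    by linarith
  then show ?thesis using that by force
qed

lemma vk_ivk: "vk (ivk j) = j"
proof (cases j rule: value_cases)
  case 1
  then show ?thesis using ivk_1 vk_l2 by simp
next
  case 2
  then have "vk (j + l2) = j" using n_eq by (subst vk_high) auto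
  then show ?thesis using ivk_low[OF 2] by simp
next
  case 3
  then have "vk (j - l1) = j" using n_eq by (subst vk_low) auto
  then show ?thesis using ivk_high[OF 3] by simp
next
  case 4
  show ?thesis unfolding 4 ivk_n by (rule vk_Suc_l2)
next
  case 5
  show ?thesis unfolding ivk_out[OF 5] by (rule vk_out[OF 5])
qed

lemma ivk_vk: "ivk (vk i) = i"
proof (cases i rule: position_cases)
  case 1
  then have "ivk (l1 + i) = i" using n_eq by (subst ivk_high) auto
  then show ?thesis using vk_low[OF 1] by simp
next
  case 2
  show ?thesis unfolding 2 vk_l2 by (rule ivk_1)
next
  case 3
  show ?thesis unfolding 3 vk_Suc_l2 by (rule ivk_n)
next
  case 4
  then have "ivk (i - l2) = i" using n_eq by (subst ivk_low) auto
  then show ?thesis using vk_high[OF 4] by simp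
next
  case 5
  show ?thesis unfolding vk_out[OF 5] by (rule ivk_out[OF 5])
qed

lemma vk_mem: "i \<in> {1..n} \<Longrightarrow> vk i \<in> {1..n}"
  using ivk_vk[of i] ivk_out[of "vk i"] by metis

lemma ivk_mem: "j \<in> {1..n} \<Longrightarrow> ivk j \<in> {1..n}"
  using vk_ivk[of j] vk_out[of "ivk j"] by metis

lemma vk_permutes: "vk permutes {1..n}"
proof (rule bij_imp_permutes)
  show "bij_betw vk {1..n} {1..n}"
    by (rule bij_betw_byWitness[of _ ivk]) (use vk_mem ivk_mem in \<open>auto simp only: vk_ivk ivk_vk\<close>)
qed (rule vk_out)

lemma inv_vk: "inv' vk = ivk"
  by (rule inv_unique_comp) (auto simp: vk_ivk ivk_vk)

abbreviation swap :: "nat \<Rightarrow> nat" where "swap \<equiv> transposition l2 (l2 + 1)"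

lemma swap_permutes: "swap permutes {1..n}"
  using l1 l2 n_eq by (intro permutes_swap_id) auto

lemma vk_swap_permutes: "vk \<circ> swap permutes {1..n}"
  by (rule permutes_compose[OF swap_permutes vk_permutes])

lemma inv_vk_swap: "inv' (vk \<circ> swap) = swap \<circ> ivk"
  using vk_permutes swap_permutes by (simp add: o_inv_distrib permutes_bij inv_vk)

lemma ivk_image: "ivk ` {1..l1} = A2"
proof (intro equalityI subsetI)
  fix x assume x: "x \<in> A2"
  show "x \<in> ivk ` {1..l1}"
  proof (cases "x = l2")
    case True
    then show ?thesis using l1 ivk_1 by (intro image_eqI[of _ _ 1]) auto
  next
    case False
    then have "2 \<le> x - l2" "x - l2 \<le> l1" "x - l2 + l2 = x"
      using x n_eq by (auto simp: A2_def)
    then show ?thesis using ivk_low[of "x - l2"] by (intro image_eqI[of _ _ "x - l2"]) auto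
  qed
next
  fix x assume "x \<in> ivk ` {1..l1}"
  then obtain j where j: "x = ivk j" "1 \<le> j" "j \<le> l1" by auto
  show "x \<in> A2"
  proof (cases "j = 1")
    case True
    then show ?thesis using j ivk_1 by (simp add: A2_def)
  next
    case False
    then have "ivk j = j + l2" using j by (intro ivk_low) auto
    then show ?thesis using j False n_eq by (auto simp: A2_def)
  qed
qed

lemma swap_A2: "swap ` A2 = A1"
proof -
  have "swap ` {l2 + 2..n} = {l2 + 2..n}"
    by (rule transpose_image_eq) auto
  moreover have "A1 = insert (l2 + 1) {l2 + 2..n}"
    using n_eq l1 by (auto simp: A1_def)
  ultimately show ?thesis by (simp add: A2_def)
qed

lemma swap_A1: "swap ` A1 = A2"
  unfolding swap_A2[symmetric] by (simp add: image_comp)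

lemma A1_neq_A2: "A1 \<noteq> A2"
proof -
  have "l2 \<notin> A1" "l2 \<in> A2" by (simp_all add: A1_def A2_def)
  then show ?thesis by blast
qed

lemma card_A1: "card A1 = l1" and card_A2: "card A2 = l1"
  using l1 n_eq by (simp_all add: A1_def A2_def)

lemma A_subset: "A1 \<subseteq> {1..n}" "A2 \<subseteq> {1..n}"
  using l1 l2 n_eq by (auto simp: A1_def A2_def)

lemma swap_other: "i \<noteq> l2 \<Longrightarrow> i \<noteq> l2 + 1 \<Longrightarrow> swap i = i"
  by (rule transpose_apply_other)

lemma ivk_strict_mono: "strict_mono_on {1..l1} ivk" "strict_mono_on {l1 + 1..n} ivk"
proof -
  show "strict_mono_on {1..l1} ivk"
  proof (rule strict_mono_onI)
    fix r s assume *: "r \<in> {1..l1}" "s \<in> {1..l1}" "r < s"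
    then have "ivk s = s + l2" by (intro ivk_low) auto
    moreover have "ivk r \<le> r + l2" using * ivk_low[of r] ivk_1 by (cases "r = 1") auto
    ultimately show "ivk r < ivk s" using * by simp
  qed
  show "strict_mono_on {l1 + 1..n} ivk"
  proof (rule strict_mono_onI)
    fix r s assume *: "r \<in> {l1 + 1..n}" "s \<in> {l1 + 1..n}" "r < s"
    then have "ivk r = r - l1" by (intro ivk_high) auto
    moreover have "ivk s \<ge> s - l1" using * ivk_high[of s] ivk_n n_eq by (cases "s = n") auto
    ultimately show "ivk r < ivk s" using * by auto
  qed
qed

lemma vk_coset_reps: "vk \<in> coset_reps n l1"
  using vk_permutes ivk_strict_mono by (simp add: coset_reps_def inv_vk)

text \<open>\<open>swap\<close> moves the position of \<open>1\<close> from \<open>l2\<close> to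
  \<open>l2 + 1\<close>, still before all \<open>j + l2\<close> with \<open>j \<ge> 2\<close>, and
  that of \<open>n\<close> from \<open>l2 + 1\<close> to \<open>l2\<close>, still after
  \<open>l2 - 1\<close>. So both increasing sequences stay increasing.\<close>

lemma vk_swap_coset_reps: "vk \<circ> swap \<in> coset_reps n l1"
proof -
  have "strict_mono_on {1..l1} (swap \<circ> ivk)"
  proof (rule strict_mono_onI)
    fix r s assume *: "r \<in> {1..l1}" "s \<in> {1..l1}" "r < s"
    then have "ivk s = s + l2" by (intro ivk_low) auto
    then have "swap (ivk s) = s + l2" using * by (subst swap_other) auto
    moreover have "swap (ivk r) \<le> r + l2"
      using * ivk_low[of r] ivk_1 swap_other[of "r + l2"] by (cases "r = 1") auto
    ultimately show "(swap \<circ> ivk) r < (swap \<circ> ivk) s" using * by simp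
  qed
  moreover have "strict_mono_on {l1 + 1..n} (swap \<circ> ivk)"
  proof (rule strict_mono_onI)
    fix r s assume *: "r \<in> {l1 + 1..n}" "s \<in> {l1 + 1..n}" "r < s"
    then have "ivk r = r - l1" by (intro ivk_high) auto
    then have "swap (ivk r) = r - l1" using * n_eq by (subst swap_other) auto
    moreover have "swap (ivk s) \<ge> s - l1"
    proof (cases "s = n")
      case True
      then show ?thesis using n_eq by (simp add: ivk_n)
    next
      case False
      then have "ivk s = s - l1" using * by (intro ivk_high) auto
      moreover have "swap (s - l1) = s - l1" using * False n_eq by (intro swap_other) auto
      ultimately show ?thesis by simp
    qed
    ultimately show "(swap \<circ> ivk) r < (swap \<circ> ivk) s" using * by auto
  qed
  ultimately show ?thesis
    using vk_swap_permutes unfolding coset_reps_def mem_Collect_eq inv_vk_swap by blast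
qed

lemma inv_vk_image: "inv' vk ` {1..l1} = A2"
  unfolding inv_vk by (rule ivk_image)

lemma inv_vk_swap_image: "inv' (vk \<circ> swap) ` {1..l1} = A1"
  unfolding inv_vk_swap image_comp[symmetric] ivk_image by (rule swap_A2)

text \<open>\<open>vk \<circ> swap\<close> has the values \<open>n\<close> and \<open>1\<close> at
  the positions \<open>l2\<close> and \<open>l2 + 1\<close>; undoing this inversion gives
  \<open>vk\<close>.\<close>

lemma bruhat_vk_swap: "bruhat_le n vk (vk \<circ> swap)"
proof -
  have "(vk \<circ> swap) l2 = n" "(vk \<circ> swap) (l2 + 1) = 1"
    using l1 l2 n_eq by (auto simp: vk_apply)
  then have "inversion_number n (vk \<circ> swap \<circ> swap) < inversion_number n (vk \<circ> swap)"
    using l1 l2 n_eq by (intro inversion_number_transpose_less) auto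
  then have "inversion_number n vk < inversion_number n (vk \<circ> swap)"
    by (simp add: comp_assoc)
  moreover have "l2 \<in> {1..n}" "l2 + 1 \<in> {1..n}" using l1 l2 n_eq by auto
  ultimately show ?thesis
    unfolding bruhat_le_def using vk_permutes by (intro r_into_rtrancl) blast
qed

text \<open>Ranks are compared at the positions \<open>l2 - 1\<close> and \<open>l2 + 1\<close>. The
  first keeps the set of positions of the values up to \<open>l1\<close> away from
  \<open>{1..l2 - 1}\<close>; the second keeps \<open>l2\<close> and \<open>l2 + 1\<close> from both
  being in it. So the set lies in \<open>A1\<close> or \<open>A2\<close>, with equality by
  cardinality.\<close>

lemma bruhat_vk_cases:
  assumes "v \<in> coset_reps n l1" "bruhat_le n vk v"
  shows "v = vk \<or> v = vk \<circ> swap"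
proof -
  have v: "v permutes {1..n}" using assms by (simp add: coset_reps_def)
  let ?A = "inv' v ` {1..l1}"
  have A: "p \<in> ?A \<longleftrightarrow> p \<in> {1..n} \<and> v p \<le> l1" for p
  proof -
    have "p \<in> ?A \<longleftrightarrow> v p \<in> {1..l1}"
      using permutes_inverses[OF v] by (metis image_iff)
    moreover have "v p \<ge> 1 \<longleftrightarrow> p \<in> {1..n}" if "v p \<le> l1"
      using permutes_in_image[OF v, of p] that n_eq by auto
    ultimately show ?thesis by auto
  qed
  have cardA: "card ?A = l1"
    using permutes_inj[OF permutes_inv[OF v]] by (simp add: card_image inj_on_subset)
  have "{p \<in> {1..l2 - 1}. vk p \<le> l1} = {}"
    using l1 l2 n_eq by (auto simp: vk_apply)
  then have "low_count l1 (l2 - 1) vk = 0" by (simp only: low_count_def card.empty)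
  then have "low_count l1 (l2 - 1) v = 0"
    using low_count_bruhat_le[OF assms(2), of l1 "l2 - 1"] by simp
  then have "{p \<in> {1..l2 - 1}. v p \<le> l1} = {}" by (simp add: low_count_def)
  then have low: "p \<in> {l2..n}" if "p \<in> ?A" for p
    using that unfolding A by (cases "p < l2") auto
  have "{p \<in> {1..l2 + 1}. vk p \<le> l1} \<subseteq> {l2}"
    using l1 l2 n_eq by (auto simp: vk_apply split: if_splits)
  then have "low_count l1 (l2 + 1) vk \<le> 1"
    unfolding low_count_def using card_mono[of "{l2}"] by fastforce
  then have "low_count l1 (l2 + 1) v \<le> 1"
    using low_count_bruhat_le[OF assms(2), of l1 "l2 + 1"] by simp
  moreover have "2 \<le> low_count l1 (l2 + 1) v" if "l2 \<in> ?A" "l2 + 1 \<in> ?A"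
  proof -
    have "card {l2, l2 + 1} \<le> low_count l1 (l2 + 1) v"
      unfolding low_count_def using that A l2 by (intro card_mono) auto
    then show ?thesis by simp
  qed
  ultimately have "l2 \<notin> ?A \<or> l2 + 1 \<notin> ?A" by linarith
  moreover have "p \<in> A1" if "l2 \<notin> ?A" "p \<in> ?A" for p
    using low[OF that(2)] that by (cases "p = l2") (simp_all add: A1_def)
  moreover have "p \<in> A2" if "l2 + 1 \<notin> ?A" "p \<in> ?A" for p
    using low[OF that(2)] that by (cases "p = l2 + 1"; cases "p = l2") (simp_all add: A2_def)
  ultimately have "?A \<subseteq> A1 \<or> ?A \<subseteq> A2" by blast
  then have "?A = A1 \<or> ?A = A2"
    using card_subset_eq[of A1 ?A] card_subset_eq[of A2 ?A] cardA card_A1 card_A2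
    by (auto simp: A1_def A2_def)
  moreover note inv_vk_swap_image inv_vk_image
  moreover have "l1 \<le> n" using n_eq by simp
  ultimately show ?thesis
    using coset_reps_unique[OF assms(1) vk_coset_reps] coset_reps_unique[OF assms(1) vk_swap_coset_reps]
    by metis
qed

section \<open>The class and its translates as explicit products\<close>

definition C0 :: "nat set" where "C0 = {p \<in> {1..l2 - 1}. l2 \<le> h p}"

definition R :: "(nat \<times> nat) set" where
  "R = {(p, q). p \<in> {1..l2 - 1} \<and> q \<in> {l2 + 2..n} \<and> q \<le> h p}"

text \<open>The product over \<open>Sset\<close>, written in the values of \<open>w\<close> instead
  of those of its Young factor. The positions \<open>x\<close> and \<open>z\<close> stand for
  \<open>l2\<close> and \<open>l2 + 1\<close>, and trade roles when \<open>w\<close> lies over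
  \<open>vk \<circ> swap\<close>.\<close>

definition G :: "nat \<Rightarrow> nat \<Rightarrow> (nat \<Rightarrow> nat) \<Rightarrow> cpoly" where
  "G x z w = (\<Prod>p\<in>C0. tvar (w x) - tvar (w p)) * (\<Prod>q\<in>{l2 + 2..n}. tvar (w q) - tvar (w z)) *
     (\<Prod>(p, q)\<in>R. tvar (w q) - tvar (w p))"

text \<open>The common form of all translates, indexed by the image \<open>I\<close> of
  \<open>{1..l1}\<close>. As \<open>A1\<close> and \<open>A2\<close> differ, at most one of the two
  conditions on a permutation \<open>w\<close> can hold.\<close>

definition cls :: "nat set \<Rightarrow> (nat \<Rightarrow> nat) \<Rightarrow> cpoly" where
  "cls I w = (if w permutes {1..n} then
     if w ` A2 = I then G l2 (l2 + 1) w else if w ` A1 = I then G (l2 + 1) l2 w else 0 else 0)"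

lemma finite_C0 [simp]: "finite C0" by (simp add: C0_def)

lemma finite_R [simp]: "finite R"
  by (rule finite_subset[of _ "{1..l2 - 1} \<times> {l2 + 2..n}"]) (auto simp: R_def)

lemma C0_less: "p \<in> C0 \<Longrightarrow> 1 < p \<and> p < l2"
  using h1 l2 unfolding C0_def by (cases "p = 1") auto

text \<open>All positions in \<open>C0\<close>, in the pairs of \<open>R\<close> and in
  \<open>{l2 + 2..n}\<close> are fixed by \<open>swap\<close>, so only the two arguments are
  exchanged.\<close>

lemma G_swap: "G (l2 + 1) l2 (w \<circ> swap) = G l2 (l2 + 1) w"
proof -
  have "(\<Prod>p\<in>C0. tvar ((w \<circ> swap) (l2 + 1)) - tvar ((w \<circ> swap) p)) = (\<Prod>p\<in>C0. tvar (w l2) - tvar (w p))"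
    by (intro prod.cong) (auto simp: Transposition.transpose_def dest: C0_less)
  moreover have "(\<Prod>q\<in>{l2 + 2..n}. tvar ((w \<circ> swap) q) - tvar ((w \<circ> swap) l2)) =
      (\<Prod>q\<in>{l2 + 2..n}. tvar (w q) - tvar (w (l2 + 1)))"
    by (intro prod.cong) (auto simp: Transposition.transpose_def)
  moreover have "(\<Prod>(p, q)\<in>R. tvar ((w \<circ> swap) q) - tvar ((w \<circ> swap) p)) =
      (\<Prod>(p, q)\<in>R. tvar (w q) - tvar (w p))"
    by (intro prod.cong) (auto simp: Transposition.transpose_def R_def)
  ultimately show ?thesis unfolding G_def by presburger
qed

text \<open>Through \<open>a = vk q\<close>, \<open>b = vk p\<close>, the roots in
  \<open>Sset\<close> become the inversions \<open>p < q\<close> of \<open>vk\<close> with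
  \<open>q \<le> h p\<close>. They fall into three kinds: \<open>q = l2\<close> with
  \<open>p \<in> C0\<close>, \<open>p = l2 + 1\<close> with any \<open>q \<ge> l2 + 2\<close>, and
  the pairs in \<open>R\<close>.\<close>

lemma Sset_prod:
  "(\<Prod>(a, b)\<in>Sset n h l1 (l2 - 1). tvar (y a) - tvar (y b)) = G l2 (l2 + 1) (y \<circ> vk)"
proof -
  let ?P1 = "(\<lambda>p. (p, l2)) ` C0" and ?P2 = "(\<lambda>q. (l2 + 1, q)) ` {l2 + 2..n}"
  let ?\<phi> = "\<lambda>(p, q). (vk q, vk p)" and ?f = "\<lambda>(p, q). tvar (y (vk q)) - tvar (y (vk p))"
  have inv_pairs: "p < q \<and> vk q < vk p \<and> q \<le> h p \<longleftrightarrow> (p, q) \<in> ?P1 \<union> ?P2 \<union> R"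
    if "p \<in> {1..n}" "q \<in> {1..n}" for p q
  proof -
    \<comment> \<open>If \<open>l2 + 2 \<le> n\<close> then \<open>l1 > 1\<close>, and the
      hypothesis on \<open>h (l2 + 1)\<close> admits every such \<open>q\<close>; otherwise there is
      no such \<open>q\<close>.\<close>
    have "h (l2 + 1) = n" if "l2 + 2 \<le> n" using hl2 that n_eq by simp
    moreover have "(p, q) \<in> ?P1 \<longleftrightarrow> p \<in> C0 \<and> q = l2" "(p, q) \<in> ?P2 \<longleftrightarrow> p = l2 + 1 \<and> q \<in> {l2 + 2..n}"
      by auto
    ultimately show ?thesis using that l1 l2 n_eq unfolding vk_apply C0_def R_def by auto
  qed
  have P_sub: "?P1 \<union> ?P2 \<union> R \<subseteq> {1..n} \<times> {1..n}"
    using l1 l2 n_eq by (auto simp: R_def C0_def)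
  have "Sset n h l1 (l2 - 1) = ?\<phi> ` (?P1 \<union> ?P2 \<union> R)"
  proof (intro equalityI subsetI)
    fix z assume "z \<in> Sset n h l1 (l2 - 1)"
    then obtain a b where z: "z = (a, b)" "a \<in> {1..n}" "b \<in> {1..n}" "a < b" "ivk b < ivk a" "ivk a \<le> h (ivk b)"
      unfolding Sset_def vk_def[symmetric] inv_vk by blast
    have "ivk a \<in> {1..n}" "ivk b \<in> {1..n}"
      using z permutes_in_image[OF permutes_inv[OF vk_permutes]] unfolding inv_vk by blast+
    then have "(ivk b, ivk a) \<in> ?P1 \<union> ?P2 \<union> R"
      using inv_pairs[of "ivk b" "ivk a"] z by (simp add: vk_ivk)
    then show "z \<in> ?\<phi> ` (?P1 \<union> ?P2 \<union> R)"
      by (intro image_eqI[of _ _ "(ivk b, ivk a)"]) (auto simp: z vk_ivk)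
  next
    fix z assume "z \<in> ?\<phi> ` (?P1 \<union> ?P2 \<union> R)"
    then obtain r where r: "r \<in> ?P1 \<union> ?P2 \<union> R" "z = ?\<phi> r" by (rule imageE)
    obtain p q where "r = (p, q)" by (rule prod.exhaust)
    then have z: "z = (vk q, vk p)" and pq: "(p, q) \<in> ?P1 \<union> ?P2 \<union> R"
      using r by (simp_all only: prod.case)
    have mem: "p \<in> {1..n}" "q \<in> {1..n}" using subsetD[OF P_sub pq] by simp_all
    moreover have "vk p \<in> {1..n}" "vk q \<in> {1..n}"
      using mem permutes_in_image[OF vk_permutes] by blast+
    ultimately show "z \<in> Sset n h l1 (l2 - 1)"
      using inv_pairs[OF mem] pq unfolding z Sset_def vk_def[symmetric] inv_vk by (simp add: ivk_vk)
  qed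
  moreover have "inj_on ?\<phi> (?P1 \<union> ?P2 \<union> R)"
    using permutes_inj[OF vk_permutes] by (auto intro!: inj_onI dest: injD)
  moreover have "(\<lambda>(a, b). tvar (y a) - tvar (y b)) \<circ> ?\<phi> = ?f" by auto
  ultimately have "(\<Prod>(a, b)\<in>Sset n h l1 (l2 - 1). tvar (y a) - tvar (y b)) = prod ?f (?P1 \<union> ?P2 \<union> R)"
    using prod.reindex[of ?\<phi> "?P1 \<union> ?P2 \<union> R" "\<lambda>(a, b). tvar (y a) - tvar (y b)"] by presburger
  also have "\<dots> = prod ?f ?P1 * prod ?f ?P2 * prod ?f R"
  proof -
    have "?P1 \<inter> ?P2 = {}" "(?P1 \<union> ?P2) \<inter> R = {}" by (auto simp: R_def C0_def)
    then show ?thesis by (simp add: prod.union_disjoint)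
  qed
  also have "\<dots> = G l2 (l2 + 1) (y \<circ> vk)"
    unfolding G_def by (simp add: prod.reindex inj_on_def)
  finally show ?thesis .
qed

text \<open>The representative in the factorization of \<open>w\<close> is recognized by the set of
  positions that \<open>w\<close> maps onto \<open>{1..l1}\<close>; this set is \<open>A2\<close>
  for \<open>vk\<close>, \<open>A1\<close> for \<open>vk \<circ> swap\<close>, and neither for the
  others.\<close>

lemma fclass_eq_cls: "fclass n h l1 (l2 - 1) = cls {1..l1}"
proof (rule ext)
  fix w
  show "fclass n h l1 (l2 - 1) w = cls {1..l1} w"
  proof (cases "w permutes {1..n}")
    case True
    have l1n: "l1 \<le> n" using n_eq by simp
    obtain y v where yv: "y \<in> block_perms n l1" "v \<in> coset_reps n l1" "w = y \<circ> v"
      using coset_decomposition_exists[OF True l1n] by blast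
    have y: "y permutes {1..n}" "y ` {1..l1} = {1..l1}" and v: "v permutes {1..n}"
      using yv by (auto simp: block_perms_def coset_reps_def)
    have f: "fclass n h l1 (l2 - 1) w = (if bruhat_le n vk v then G l2 (l2 + 1) (y \<circ> vk) else 0)"
      using True coset_decomposition_THE[OF yv l1 l1n]
      unfolding fclass_def Sset_prod vk_def[symmetric] by simp
    have im: "w ` A = {1..l1} \<longleftrightarrow> inv' v ` {1..l1} = A" for A
    proof -
      have "w ` A = {1..l1} \<longleftrightarrow> A = inv' w ` {1..l1}"
        using permutes_bij[OF True] by (metis bij_betw_def image_inv_f_f image_f_inv_f)
      then show ?thesis using block_perms_inv_image[OF yv(1) v] yv(3) by auto
    qed
    note imA1 = inv_vk_swap_image and imA2 = inv_vk_image
    consider "v = vk" | "v = vk \<circ> swap" | "v \<noteq> vk" "v \<noteq> vk \<circ> swap" by blast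
    then show ?thesis
    proof cases
      case 1
      then have "w ` A2 = {1..l1}" using im imA2 by blast
      moreover have "bruhat_le n vk v" unfolding 1 bruhat_le_def by simp
      ultimately show ?thesis using True f yv(3) 1 by (simp add: cls_def)
    next
      case 2
      then have "w ` A1 = {1..l1}" "w ` A2 \<noteq> {1..l1}" using im imA1 A1_neq_A2 by auto
      moreover have "bruhat_le n vk v" using bruhat_vk_swap 2 by simp
      \<comment> \<open>The class is given by \<open>y \<circ> vk\<close>, which here differs from
        \<open>w\<close> by \<open>swap\<close>; \<open>G_swap\<close> translates it into the other
        product.\<close>
      moreover have "w = (y \<circ> vk) \<circ> swap" using yv(3) 2 by (simp add: comp_assoc)
      ultimately show ?thesis using True f G_swap[of "y \<circ> vk"] by (simp add: cls_def)
    next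
      case 3
      then have "\<not> bruhat_le n vk v" using bruhat_vk_cases[OF yv(2)] by blast
      moreover have "w ` A1 \<noteq> {1..l1}"
        using 3 im coset_reps_unique[OF yv(2) vk_swap_coset_reps _ l1n] imA1 by metis
      moreover have "w ` A2 \<noteq> {1..l1}"
        using 3 im coset_reps_unique[OF yv(2) vk_coset_reps _ l1n] imA2 by metis
      ultimately show ?thesis using f by (simp add: cls_def)
    qed
  qed (simp add: fclass_def cls_def)
qed

text \<open>Modulo the difference of the two exchanged variables every factor is unchanged, hence so
  is the product.\<close>

lemma G_cong:
  assumes "w permutes {1..n}" "i \<in> {1..n}" "j \<in> {1..n}" "x \<in> {1..n}" "z \<in> {1..n}"
  shows "cong_mod n (tvar (w i) - tvar (w j)) (G x z w) (G x z (w \<circ> transposition i j))"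
  unfolding G_def case_prod_beta comp_apply using assms l1 l2 n_eq
  by (intro cong_mod_mult cong_mod_prod cong_mod_diff cong_mod_tvar_transpose)
    (auto simp: C0_def R_def)

lemma G_factor_polyring:
  assumes "w permutes {1..n}" "x \<in> {1..n}" "z \<in> {1..n}"
  shows "\<And>p. p \<in> C0 \<Longrightarrow> tvar (w x) - tvar (w p) \<in> polyring n"
    "\<And>q. q \<in> {l2 + 2..n} \<Longrightarrow> tvar (w q) - tvar (w z) \<in> polyring n"
    "\<And>r. r \<in> R \<Longrightarrow> (case r of (p, q) \<Rightarrow> tvar (w q) - tvar (w p)) \<in> polyring n"
proof -
  have mem: "tvar (w b) \<in> polyring n" if "b \<in> {1..n}" for b
    using permutes_in_image[OF assms(1)] that by (intro polyring_tvar) blast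
  show "tvar (w x) - tvar (w p) \<in> polyring n" if "p \<in> C0" for p
    using that assms n_eq by (intro polyring_diff mem) (auto simp: C0_def)
  show "tvar (w q) - tvar (w z) \<in> polyring n" if "q \<in> {l2 + 2..n}" for q
    using that assms n_eq by (intro polyring_diff mem) auto
  show "(case r of (p, q) \<Rightarrow> tvar (w q) - tvar (w p)) \<in> polyring n" if "r \<in> R" for r
    using that assms n_eq unfolding case_prod_beta by (intro polyring_diff mem) (auto simp: R_def)
qed

lemma G_polyring:
  assumes "w permutes {1..n}" "x \<in> {1..n}" "z \<in> {1..n}" shows "G x z w \<in> polyring n"
  unfolding G_def by (intro polyring_mult polyring_prod G_factor_polyring[OF assms])

text \<open>The three alternatives are the three families of factors of \<open>G\<close>; the
  cofactor is the product of all remaining factors.\<close>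

lemma G_dvd:
  assumes "w permutes {1..n}" "x \<in> {1..n}" "z \<in> {1..n}"
    and "(j \<in> C0 \<and> i = x) \<or> (j = z \<and> i \<in> {l2 + 2..n}) \<or> (j, i) \<in> R"
  shows "\<exists>q\<in>polyring n. G x z w = (tvar (w i) - tvar (w j)) * q"
proof -
  note fac = G_factor_polyring[OF assms(1-3)]
  let ?a = "\<Prod>p\<in>C0. tvar (w x) - tvar (w p)" and ?b = "\<Prod>q\<in>{l2 + 2..n}. tvar (w q) - tvar (w z)"
    and ?c = "\<Prod>(p, q)\<in>R. tvar (w q) - tvar (w p)"
  have mem: "?a \<in> polyring n" "?b \<in> polyring n" "?c \<in> polyring n"
    by (intro polyring_prod fac; assumption)+
  from assms(4) consider "j \<in> C0" "i = x" | "j = z" "i \<in> {l2 + 2..n}" | "(j, i) \<in> R" by blast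
  then show ?thesis
  proof cases
    case 1
    obtain q where "q \<in> polyring n" "?a = (tvar (w x) - tvar (w j)) * q"
      using dvd_prod_polyring[OF finite_C0 1(1), of "\<lambda>p. tvar (w x) - tvar (w p)"] fac(1) by blast
    then show ?thesis using mem 1 unfolding G_def by (intro bexI[of _ "q * ?b * ?c"]) (simp_all add: mult.assoc)
  next
    case 2
    obtain q where "q \<in> polyring n" "?b = (tvar (w i) - tvar (w z)) * q"
      using dvd_prod_polyring[OF _ 2(2), of "\<lambda>q. tvar (w q) - tvar (w z)"] fac(2) by blast
    then show ?thesis using mem 2 unfolding G_def by (intro bexI[of _ "q * ?a * ?c"]) (simp_all add: mult_ac)
  next
    case 3
    obtain q where "q \<in> polyring n" "?c = (tvar (w i) - tvar (w j)) * q"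
      using dvd_prod_polyring[where f = "\<lambda>(p, q). tvar (w q) - tvar (w p)", OF finite_R 3 fac(3)]
      unfolding prod.case by blast
    then show ?thesis using mem 3 unfolding G_def by (intro bexI[of _ "q * ?a * ?b"]) (simp_all add: mult_ac)
  qed
qed

section \<open>The divisibility conditions for the translates\<close>

lemma l2_mem: "l2 \<in> {1..n}" "l2 + 1 \<in> {1..n}"
  using n_ge l2 by auto

context
  fixes i j assumes ij: "i \<in> {1..n}" "j \<in> {1..n}" "j < i" "i \<le> h j"
begin

text \<open>This covers transpositions leading from a nonzero product to the value \<open>0\<close>.
  Exactly one of \<open>i\<close>, \<open>j\<close> lies in \<open>A2\<close> and the pair is not
  that of \<open>swap\<close>; the remaining pairs with \<open>i \<le> h j\<close> each supply a
  factor of \<open>G l2 (l2 + 1)\<close>.\<close>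

lemma transpose_ij_A2:
  assumes "transposition i j ` A2 \<noteq> A2" "transposition i j ` A1 \<noteq> A2"
  shows "(j \<in> C0 \<and> i = l2) \<or> (j = l2 + 1 \<and> i \<in> {l2 + 2..n}) \<or> (j, i) \<in> R"
proof -
  have "(i \<in> A2) \<noteq> (j \<in> A2)" using assms(1) transpose_image_eq[of i _ j] by metis
  moreover have "\<not> (j = l2 \<and> i = l2 + 1)"
    using assms(2) swap_A1 by (auto simp: transpose_commute)
  ultimately show ?thesis using ij unfolding A2_def C0_def R_def by auto
qed

text \<open>As for \<open>A2\<close>; for \<open>i = l2 + 1\<close> and \<open>j < l2\<close> the
  condition \<open>l2 + 1 \<le> h j\<close> is stronger than the one defining
  \<open>C0\<close>.\<close>

lemma transpose_ij_A1:
  assumes "transposition i j ` A1 \<noteq> A1" "transposition i j ` A2 \<noteq> A1"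
  shows "(j \<in> C0 \<and> i = l2 + 1) \<or> (j = l2 \<and> i \<in> {l2 + 2..n}) \<or> (j, i) \<in> R"
proof -
  have "(i \<in> A1) \<noteq> (j \<in> A1)" using assms(1) transpose_image_eq[of i _ j] by metis
  moreover have "\<not> (j = l2 \<and> i = l2 + 1)"
    using assms(2) swap_A2 by (auto simp: transpose_commute)
  ultimately show ?thesis using ij unfolding A1_def C0_def R_def by auto
qed

text \<open>\<open>l2\<close> lies only in \<open>A2\<close> and \<open>l2 + 1\<close> only in
  \<open>A1\<close>, so the transposition must move both.\<close>

lemma transpose_ij_A1_A2:
  assumes "transposition i j ` A1 = A2" shows "transposition i j = swap"
proof -
  have "l2 \<in> transposition i j ` A1" unfolding assms by (simp add: A2_def)
  then obtain x where x: "x \<in> A1" "l2 = transposition i j x" by (rule imageE)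
  have "x \<noteq> l2" using x(1) by (simp add: A1_def)
  then have "l2 \<in> {i, j}"
    using x(2) by (cases "x = i"; cases "x = j") auto
  moreover have "transposition i j (l2 + 1) \<in> A2"
    unfolding assms[symmetric] using l1 n_eq by (intro imageI) (simp add: A1_def)
  then have "l2 + 1 \<in> {i, j}"
    by (cases "l2 + 1 = i"; cases "l2 + 1 = j") (auto simp: A2_def)
  ultimately have "j = l2" "i = l2 + 1" using ij(3) by auto
  then show ?thesis by (simp add: transpose_commute)
qed

definition gkm_at :: "nat set \<Rightarrow> (nat \<Rightarrow> nat) \<Rightarrow> bool" where
  "gkm_at I w \<longleftrightarrow> (\<exists>q\<in>polyring n. cls I w - cls I (w \<circ> transposition i j) = (tvar (w i) - tvar (w j)) * q)"

lemma comp_transp_permutes: "w permutes {1..n} \<Longrightarrow> w \<circ> transposition i j permutes {1..n}"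
  by (rule permutes_compose[OF permutes_swap_id[OF ij(1,2)]])

text \<open>Passing to the other end of the edge changes the sign of both the difference and the
  divisor. It thus suffices to treat one end where the class is given by a product.\<close>

lemma gkm_at_sym:
  assumes "gkm_at I (w \<circ> transposition i j)" shows "gkm_at I w"
proof -
  obtain q where q: "q \<in> polyring n" "cls I (w \<circ> transposition i j) - cls I w = (tvar (w j) - tvar (w i)) * q"
    using assms unfolding gkm_at_def by (auto simp: comp_assoc)
  have "cls I w - cls I (w \<circ> transposition i j) = (tvar (w i) - tvar (w j)) * q"
    using arg_cong[OF q(2), of uminus] by (simp add: algebra_simps)
  then show ?thesis using q(1) unfolding gkm_at_def by blast
qed

lemma comp_transp_image: "inj w \<Longrightarrow> (w \<circ> transposition i j) ` A = w ` B \<longleftrightarrow> transposition i j ` A = B"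
  by (simp only: image_comp[symmetric] inj_image_eq_iff)

text \<open>The other end of the edge has the same product formula, or the other one, or the value
  \<open>0\<close>. The difference is then divisible by congruence of the products, or zero since
  the edge is \<open>swap\<close>, or divisible because the root is a factor.\<close>

lemma gkm_at_A2:
  assumes w: "w permutes {1..n}" and I: "w ` A2 = I" shows "gkm_at I w"
proof -
  note wt = comp_transp_permutes[OF w] and im = comp_transp_image[OF permutes_inj[OF w]]
  have l2n: "l2 \<in> {1..n}" "l2 + 1 \<in> {1..n}" using l1 l2 n_eq by auto
  have c: "cls I w = G l2 (l2 + 1) w" using w I by (simp add: cls_def)
  consider "transposition i j ` A2 = A2" | "transposition i j ` A2 \<noteq> A2" "transposition i j ` A1 = A2"
    | "transposition i j ` A2 \<noteq> A2" "transposition i j ` A1 \<noteq> A2" by blast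
  then show ?thesis
  proof cases
    case 1
    then have "cls I (w \<circ> transposition i j) = G l2 (l2 + 1) (w \<circ> transposition i j)"
      using wt im I[symmetric] by (simp only: cls_def simp_thms if_True if_False)
    then show ?thesis
      using G_cong[OF w ij(1,2) l2n] c by (simp add: gkm_at_def cong_mod_def)
  next
    case 2
    then have "cls I (w \<circ> transposition i j) = G (l2 + 1) l2 (w \<circ> transposition i j)"
      using wt im I[symmetric] by (simp only: cls_def simp_thms if_True if_False)
    also have "\<dots> = G l2 (l2 + 1) w"
      using transpose_ij_A1_A2[OF 2(2)] G_swap by simp
    finally show ?thesis using c by (auto simp: gkm_at_def intro!: bexI[of _ 0])
  next
    case 3
    then have "cls I (w \<circ> transposition i j) = 0"
      using wt im I[symmetric] by (simp only: cls_def simp_thms if_True if_False)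
    then show ?thesis using G_dvd[OF w l2n transpose_ij_A2[OF 3]] c by (simp add: gkm_at_def)
  qed
qed

lemma gkm_at_A1:
  assumes w: "w permutes {1..n}" and I: "w ` A1 = I" shows "gkm_at I w"
proof -
  note wt = comp_transp_permutes[OF w] and im = comp_transp_image[OF permutes_inj[OF w]]
  have l2n: "l2 \<in> {1..n}" "l2 + 1 \<in> {1..n}" using l1 l2 n_eq by auto
  have "w ` A2 \<noteq> I"
    using A1_neq_A2 I permutes_inj[OF w] by (metis inj_image_eq_iff)
  then have c: "cls I w = G (l2 + 1) l2 w" using w I by (simp add: cls_def)
  consider "transposition i j ` A2 = A1" | "transposition i j ` A2 \<noteq> A1" "transposition i j ` A1 = A1"
    | "transposition i j ` A1 \<noteq> A1" "transposition i j ` A2 \<noteq> A1" by blast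
  then show ?thesis
  proof cases
    case 1
    then have "(w \<circ> transposition i j) ` A2 = I" using im I by blast
    then show ?thesis using gkm_at_A2[OF wt] gkm_at_sym by blast
  next
    case 2
    then have "cls I (w \<circ> transposition i j) = G (l2 + 1) l2 (w \<circ> transposition i j)"
      using wt im I[symmetric] by (simp only: cls_def simp_thms if_True if_False)
    then show ?thesis
      using G_cong[OF w ij(1,2) l2n(2,1)] c by (simp add: gkm_at_def cong_mod_def)
  next
    case 3
    then have "cls I (w \<circ> transposition i j) = 0"
      using wt im I[symmetric] by (simp only: cls_def simp_thms if_True if_False)
    then show ?thesis using G_dvd[OF w l2n(2,1) transpose_ij_A1[OF 3]] c by (simp add: gkm_at_def)
  qed
qed

lemma gkm_at_all:
  assumes w: "w permutes {1..n}" shows "gkm_at I w"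
proof (cases "w ` A2 = I \<or> w ` A1 = I")
  case True
  then show ?thesis using gkm_at_A2[OF w] gkm_at_A1[OF w] by blast
next
  case False
  show ?thesis
  proof (cases "(w \<circ> transposition i j) ` A2 = I \<or> (w \<circ> transposition i j) ` A1 = I")
    case True
    then show ?thesis
      using gkm_at_A2 gkm_at_A1 comp_transp_permutes[OF w] gkm_at_sym by blast
  next
    case F: False
    have "cls I w = 0" "cls I (w \<circ> transposition i j) = 0"
      using False F by (simp_all only: cls_def de_Morgan_disj if_False if_cancel)
    then show ?thesis by (auto simp: gkm_at_def intro!: bexI[of _ 0])
  qed
qed

end

lemma cls_in_HT: "cls I \<in> HT n h"
  unfolding HT_def
proof (intro CollectI conjI allI impI ballI)
  fix w assume "\<not> w permutes {1..n}"
  then show "cls I w = 0" by (simp add: cls_def)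
next
  fix w assume w: "w permutes {1..n}"
  show "cls I w \<in> polyring n"
    using w G_polyring[OF w l2_mem] G_polyring[OF w l2_mem(2,1)] by (simp add: cls_def)
next
  fix w z assume w: "w permutes {1..n}" and "z \<in> N_h_neg n h w"
  then obtain i j where "z = (i, j)" "i \<in> {1..n}" "j \<in> {1..n}" "j < i" "i \<le> h j"
    by (auto simp: N_h_neg_def Phi_h_neg_def)
  then show "case z of (i, j) \<Rightarrow>
      \<exists>q\<in>polyring n. cls I w - cls I (w \<circ> transposition i j) = (tvar (w i) - tvar (w j)) * q"
    using gkm_at_all[OF _ _ _ _ w, of i j I] gkm_at_def[of i j I w] by simp
qed

end

subsection \<open>Linear independence of the orbit\<close>

lemma tvar_diff_neq_0: "inj w \<Longrightarrow> a \<noteq> b \<Longrightarrow> tvar (w a) - tvar (w b) \<noteq> 0"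
  by (simp add: inj_eq)

text \<open>A polynomial without constant term is a combination of variables, and these are sent to
  variables.\<close>

lemma augmentation_perm_poly:
  assumes "p \<in> polyring n" "Poly_Mapping.lookup p 0 = 0"
  shows "Poly_Mapping.lookup (perm_poly v p) 0 = 0"
proof -
  obtain q where "p = pconst (Poly_Mapping.lookup p 0) + (\<Sum>i\<in>{1..n}. tvar i * q i)"
    using polyring_decompose[OF assms(1)] by blast
  then have "perm_poly v p = perm_poly v (\<Sum>i\<in>{1..n}. tvar i * q i)"
    using assms(2) by simp
  then show ?thesis
    by (simp add: perm_poly_sum perm_poly_mult lookup_sum)
qed

context two_part_class
begin

text \<open>\<open>G\<close> at \<open>inv' v \<circ> w\<close> involves the variables with indices
  \<open>inv' v (w a)\<close>, and \<open>perm_poly v\<close> restores the index \<open>w a\<close>.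
  Only the condition on the image is translated by \<open>v\<close>.\<close>

lemma dot_cls:
  assumes v: "v permutes {1..n}" shows "dot v (cls I) = cls (v ` I)"
proof (rule ext)
  fix w
  have G: "perm_poly v (G x z (inv' v \<circ> w)) = G x z w" for x z
    unfolding G_def case_prod_beta perm_poly_mult perm_poly_prod perm_poly_diff perm_poly_tvar
      comp_apply permutes_inverses(1)[OF v] ..
  show "dot v (cls I) w = cls (v ` I) w"
    unfolding dot_def cls_def permutes_inv_comp_iff[OF v] image_comp[symmetric]
      permutes_image_inv_eq_iff[OF v]
    by (simp add: G)
qed

abbreviation \<Omega> :: "nat set set" where "\<Omega> \<equiv> ksubsets n l1"

lemma images_in_\<Omega>:
  assumes "w permutes {1..n}" shows "w ` A1 \<in> \<Omega>" "w ` A2 \<in> \<Omega>"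
proof -
  have "A1 \<in> \<Omega>" "A2 \<in> \<Omega>"
    unfolding ksubsets_def using A_subset card_A1 card_A2 by blast+
  then show "w ` A1 \<in> \<Omega>" "w ` A2 \<in> \<Omega>" by (simp_all only: permutes_image_ksubsets[OF assms])
qed

text \<open>The product \<open>G\<close> without its factor over \<open>R\<close>, which does not involve the positions \<open>l2\<close>, \<open>l2 + 1\<close> and cancels.\<close>

definition E :: "nat \<Rightarrow> nat \<Rightarrow> (nat \<Rightarrow> nat) \<Rightarrow> cpoly" where
  "E x z w = (\<Prod>p\<in>C0. tvar (w x) - tvar (w p)) * (\<Prod>q\<in>{l2 + 2..n}. tvar (w q) - tvar (w z))"

text \<open>Only the classes of the two distinct sets \<open>w\<close> A1\<open>and\<close>w
  \<open>A2\<close> can be nonzero at \<open>w\<close>; the nonzero factor over \<open>R\<close>,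
  common to both, is cancelled.\<close>

lemma cls_relation:
  assumes c: "\<And>w. (\<Sum>I\<in>\<Omega>. c I * cls I w) = 0" and w: "w permutes {1..n}"
  shows "c (w ` A1) * E (l2 + 1) l2 w + c (w ` A2) * E l2 (l2 + 1) w = 0"
proof -
  let ?R = "\<Prod>(p, q)\<in>R. tvar (w q) - tvar (w p)"
  have neq: "w ` A1 \<noteq> w ` A2"
    using A1_neq_A2 inj_image_eq_iff[OF permutes_inj[OF w]] by metis
  have "0 = (\<Sum>I\<in>\<Omega>. c I * cls I w)" using c by simp
  also have "\<dots> = (\<Sum>I\<in>{w ` A1, w ` A2}. c I * cls I w)"
    using images_in_\<Omega>[OF w] by (intro sum.mono_neutral_right) (auto simp: cls_def)
  also have "\<dots> = c (w ` A1) * cls (w ` A1) w + c (w ` A2) * cls (w ` A2) w"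
    using neq by simp
  also have "cls (w ` A1) w = E (l2 + 1) l2 w * ?R"
    using w neq by (simp add: cls_def G_def E_def)
  also have "cls (w ` A2) w = E l2 (l2 + 1) w * ?R"
    using w by (simp add: cls_def G_def E_def)
  finally have "(c (w ` A1) * E (l2 + 1) l2 w + c (w ` A2) * E l2 (l2 + 1) w) * ?R = 0"
    by (simp add: distrib_right mult.assoc)
  moreover have "?R \<noteq> 0"
    using permutes_inj[OF w] unfolding prod_zero_iff[OF finite_R] by (auto simp: R_def inj_eq)
  ultimately show ?thesis by simp
qed

lemma cls_independent:
  assumes c: "\<And>w. (\<Sum>I\<in>\<Omega>. c I * cls I w) = 0" and I: "I \<in> \<Omega>"
  shows "c I = 0"
proof -
  \<comment> \<open>With this choice the coefficient at \<open>I\<close> is one of the two in the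
    relation at \<open>w\<close>.\<close>
  obtain w where w: "w permutes {1..n}" and wA1: "w ` A1 = I"
    using ex_permutes_image[of "{1..n}" A1 I] I A_subset card_A1 by (auto simp: ksubsets_def)
  note inj = permutes_inj[OF w] and rel = cls_relation[of c, OF c]
  define t where "t x = tvar (w x)" for x
  define K where "K x = (\<Prod>q\<in>{l2 + 2..n}. t q - t x)" for x
  have t_neq: "t x - t y \<noteq> 0" if "x \<noteq> y" for x y
    unfolding t_def using that by (rule tvar_diff_neq_0[OF inj])
  have K_neq: "K x \<noteq> 0" if "x < l2 + 2" for x
    unfolding K_def using t_neq that by (auto simp: prod_zero_iff)
  have one: "1 \<in> {1..n}" "1 \<noteq> l2" "1 < l2" "1 \<notin> A1" "1 \<notin> A2" using n_ge l2 by (auto simp: A1_def A2_def)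
  show ?thesis
  proof (cases "C0 = {}")
    case True
    let ?B = "insert 1 {l2 + 2..n}"
    \<comment> \<open>Since \<open>1\<close> and \<open>y\<close> are below \<open>l2 + 2\<close>,
      only the argument of \<open>K\<close> is affected. As \<open>C0\<close> is empty,
      \<open>E x z\<close> is just the product that \<open>K\<close> abbreviates.\<close>
    have K_transp: "(\<Prod>q\<in>{l2 + 2..n}. tvar ((w \<circ> transposition 1 y) q) - tvar ((w \<circ> transposition 1 y) x)) = K (transposition 1 y x)"
      if "y < l2 + 2" for x y
      unfolding K_def t_def using that l2 by (intro prod.cong) (auto simp: Transposition.transpose_def)
    have w1: "w \<circ> transposition 1 y permutes {1..n}" if "y \<in> {1..n}" for y
      by (rule permutes_compose[OF permutes_swap_id[OF one(1) that] w])
    have e1: "c (w ` A1) * K l2 + c (w ` A2) * K (l2 + 1) = 0"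
      using rel[OF w] True unfolding E_def K_def t_def by simp
    have "transposition 1 l2 ` A1 = A1" using one by (intro transpose_image_eq) (auto simp: A1_def)
    moreover have "transposition 1 l2 ` A2 = ?B"
    proof -
      have "transposition 1 l2 ` {l2 + 2..n} = {l2 + 2..n}" using one by (intro transpose_image_eq) auto
      then show ?thesis by (simp add: A2_def)
    qed
    ultimately have e2: "c (w ` A1) * K 1 + c (w ` ?B) * K (l2 + 1) = 0"
      using rel[OF w1[OF l2_mem(1)]] True K_transp[of l2 l2] K_transp[of l2 "l2 + 1"] one
      unfolding E_def image_comp[symmetric] by simp
    have "transposition 1 (l2 + 1) ` A2 = A2" using one by (intro transpose_image_eq) (auto simp: A2_def)
    moreover have "transposition 1 (l2 + 1) ` A1 = ?B"
    proof -
      have "transposition 1 (l2 + 1) ` {l2 + 2..n} = {l2 + 2..n}" using one by (intro transpose_image_eq) auto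
      moreover have "A1 = insert (l2 + 1) {l2 + 2..n}" using l1 n_eq by (auto simp: A1_def)
      ultimately show ?thesis by simp
    qed
    ultimately have e3: "c (w ` ?B) * K l2 + c (w ` A2) * K 1 = 0"
      using rel[OF w1[OF l2_mem(2)]] True K_transp[of "l2 + 1" l2] K_transp[of "l2 + 1" "l2 + 1"] one
      unfolding E_def image_comp[symmetric] by simp
    have "2 * (c (w ` A1) * K l2 * K 1) =
        K 1 * (c (w ` A1) * K l2 + c (w ` A2) * K (l2 + 1)) + K l2 * (c (w ` A1) * K 1 + c (w ` ?B) * K (l2 + 1))
        - K (l2 + 1) * (c (w ` ?B) * K l2 + c (w ` A2) * K 1)"
      by (simp add: algebra_simps)
    also have "\<dots> = 0" unfolding e1 e2 e3 by simp
    finally show ?thesis using K_neq[of l2] K_neq[of 1] wA1 one by simp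
  next
    case False
    then obtain p where p: "p \<in> C0" by blast
    note p1 = C0_less[OF p]
    have one_C0: "1 \<notin> C0" using C0_less by blast
    let ?w = "w \<circ> transposition 1 p"
    define M where "M x = (\<Prod>r\<in>C0 - {p}. t x - t r)" for x
    have w': "?w permutes {1..n}"
      using p1 n_ge by (intro permutes_compose[OF permutes_swap_id w]) auto
    \<comment> \<open>Both \<open>1\<close> and \<open>p\<close> are smaller than \<open>l2\<close>,
      hence outside \<open>A1\<close> and \<open>A2\<close>, so the relation at \<open>?w\<close>
      has the same two unknowns.\<close>
    have im: "?w ` A1 = w ` A1" "?w ` A2 = w ` A2"
      unfolding image_comp[symmetric]
      using one p1 by (simp_all add: A1_def A2_def transpose_image_eq)
    have fix_w: "?w x = w x" if "x \<noteq> 1" "x \<noteq> p" for x using that by simp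
    have E: "E x z w = (t x - t p) * M x * K z" if "x \<in> {l2, l2 + 1}" for x z
      unfolding E_def M_def K_def t_def prod.remove[OF finite_C0 p] ..
    \<comment> \<open>Position \<open>p\<close> now carries \<open>w 1\<close>. As \<open>1\<close>
      is not in \<open>C0\<close>, no other factor changes.\<close>
    have E': "E x z ?w = (t x - t 1) * M x * K z" if "x \<in> {l2, l2 + 1}" "z \<in> {l2, l2 + 1}" for x z
    proof -
      have "(\<Prod>r\<in>C0. tvar (?w x) - tvar (?w r)) = (tvar (?w x) - tvar (?w p)) * (\<Prod>r\<in>C0 - {p}. tvar (?w x) - tvar (?w r))"
        by (rule prod.remove[OF finite_C0 p])
      also have "(\<Prod>r\<in>C0 - {p}. tvar (?w x) - tvar (?w r)) = M x"
        unfolding M_def t_def using that p1 one one_C0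
        by (intro prod.cong refl) (metis Diff_iff fix_w insertCI insertE less_irrefl not_add_less1 singletonD)
      also have "?w x = w x" using that p1 one by (intro fix_w) auto
      finally have 1: "(\<Prod>r\<in>C0. tvar (w x) - tvar (?w r)) = (t x - t 1) * M x"
        by (simp add: t_def)
      have 2: "(\<Prod>q\<in>{l2 + 2..n}. tvar (?w q) - tvar (?w z)) = K z"
        unfolding K_def t_def using that p1 one by (intro prod.cong) auto
      show ?thesis unfolding E_def 2 \<open>?w x = w x\<close> 1 ..
    qed
    let ?U = "c (w ` A1) * (M (l2 + 1) * K l2)" and ?Z = "c (w ` A2) * (M l2 * K (l2 + 1))"
    have e1: "?U * (t (l2 + 1) - t p) + ?Z * (t l2 - t p) = 0"
      using rel[OF w] E[of "l2 + 1" l2] E[of l2 "l2 + 1"] by (simp add: mult_ac)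
    have e2: "?U * (t (l2 + 1) - t 1) + ?Z * (t l2 - t 1) = 0"
      using rel[OF w'] E'[of "l2 + 1" l2] E'[of l2 "l2 + 1"] unfolding im by (simp add: mult_ac)
    \<comment> \<open>Elimination of \<open>?Z\<close>; the factor of \<open>?U\<close> on the left
      is the determinant of the two relations.\<close>
    have "?U * ((t (l2 + 1) - t l2) * (t p - t 1)) =
        (t l2 - t 1) * (?U * (t (l2 + 1) - t p) + ?Z * (t l2 - t p))
        - (t l2 - t p) * (?U * (t (l2 + 1) - t 1) + ?Z * (t l2 - t 1))"
      by (simp add: algebra_simps)
    also have "\<dots> = 0" unfolding e1 e2 by simp
    finally have "?U = 0" using t_neq[of "l2 + 1" l2] t_neq[of p 1] p1 by simp
    moreover have "t (l2 + 1) - t r \<noteq> 0" if "r \<in> C0" for r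
      using C0_less[OF that] by (intro t_neq) auto
    then have "M (l2 + 1) \<noteq> 0" unfolding M_def by (auto simp: prod_zero_iff)
    ultimately show ?thesis using K_neq[of l2] wA1 by simp
  qed
qed

end

subsection \<open>The span of the orbit and its character\<close>

lemma HT_0: "0 \<in> HT n h"
  by (auto simp: HT_def intro!: bexI[of _ 0])

lemma HT_congruence:
  assumes "f \<in> HT n h" "w permutes {1..n}" "(i, j) \<in> N_h_neg n h w"
  shows "\<exists>q\<in>polyring n. f w - f (w \<circ> transposition i j) = (tvar (w i) - tvar (w j)) * q"
proof -
  have "\<forall>w. w permutes {1..n} \<longrightarrow> (\<forall>(i, j)\<in>N_h_neg n h w. \<exists>q\<in>polyring n.
      f w - f (w \<circ> transposition i j) = (tvar (w i) - tvar (w j)) * q)"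
    using assms(1) unfolding HT_def mem_Collect_eq by (elim conjE)
  from bspec[OF mp[OF spec[OF this] assms(2)] assms(3)] show ?thesis unfolding prod.case .
qed

lemma HT_add:
  assumes "f \<in> HT n h" "g \<in> HT n h" shows "f + g \<in> HT n h"
  unfolding HT_def
proof (intro CollectI conjI allI impI ballI)
  fix w z assume w: "w permutes {1..n}" and z: "z \<in> N_h_neg n h w"
  obtain i j where ij: "z = (i, j)" by (cases z)
  let ?d = "tvar (w i) - tvar (w j)"
  obtain q r where qr: "q \<in> polyring n" "r \<in> polyring n"
    "f w - f (w \<circ> transposition i j) = ?d * q" "g w - g (w \<circ> transposition i j) = ?d * r"
    using HT_congruence[OF assms(1) w z[unfolded ij]] HT_congruence[OF assms(2) w z[unfolded ij]] by blast
  have "(f + g) w - (f + g) (w \<circ> transposition i j) = (f w - f (w \<circ> transposition i j)) + (g w - g (w \<circ> transposition i j))"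
    by simp
  also have "\<dots> = ?d * (q + r)" unfolding qr(3,4) distrib_left ..
  finally have "(f + g) w - (f + g) (w \<circ> transposition i j) = ?d * (q + r)" .
  moreover have "q + r \<in> polyring n" by (rule polyring_add[OF qr(1,2)])
  ultimately show "case z of (i, j) \<Rightarrow> \<exists>q\<in>polyring n.
      (f + g) w - (f + g) (w \<circ> transposition i j) = (tvar (w i) - tvar (w j)) * q"
    unfolding ij prod.case by blast
qed (use assms in \<open>auto simp: HT_def intro!: polyring_add\<close>)

lemma HT_psmult:
  assumes "f \<in> HT n h" "p \<in> polyring n" shows "psmult p f \<in> HT n h"
  unfolding HT_def
proof (intro CollectI conjI allI impI ballI)
  fix w z assume w: "w permutes {1..n}" and z: "z \<in> N_h_neg n h w"
  obtain i j where ij: "z = (i, j)" by (cases z)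
  let ?d = "tvar (w i) - tvar (w j)"
  obtain q where "q \<in> polyring n" "f w - f (w \<circ> transposition i j) = ?d * q"
    using HT_congruence[OF assms(1) w z[unfolded ij]] by blast
  then have "psmult p f w - psmult p f (w \<circ> transposition i j) = ?d * (p * q)" "p * q \<in> polyring n"
    using assms(2) unfolding psmult_def right_diff_distrib[symmetric] by (simp_all add: mult.left_commute)
  then show "case z of (i, j) \<Rightarrow> \<exists>q\<in>polyring n.
      psmult p f w - psmult p f (w \<circ> transposition i j) = (tvar (w i) - tvar (w j)) * q"
    unfolding ij prod.case by blast
qed (use assms in \<open>auto simp: HT_def psmult_def intro!: polyring_mult\<close>)

lemma vector_space_psmult_pconst: "vector_space (\<lambda>c. psmult (pconst c) :: ('w \<Rightarrow> cpoly) \<Rightarrow> 'w \<Rightarrow> cpoly)"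
  by unfold_locales
    (auto simp: psmult_def fun_eq_iff distrib_left distrib_right pconst_add pconst_mult mult.assoc)

section \<open>The orbit, its stabilizers and unique coefficients\<close>

context two_part_class
begin

text \<open>Equal classes for different subsets would give a relation with coefficients
  \<open>1\<close> and \<open>-1\<close>. Injectivity identifies the orbit with
  \<open>\<Omega>\<close> as a permuted set.\<close>

lemma inj_cls: "inj_on cls \<Omega>"
proof (rule inj_onI, rule ccontr)
  fix I J assume IJ: "I \<in> \<Omega>" "J \<in> \<Omega>" "cls I = cls J" "I \<noteq> J"
  let ?c = "\<lambda>K. (if K = I then 1 else if K = J then - 1 else 0) :: cpoly"
  have "(\<Sum>K\<in>\<Omega>. ?c K * cls K w) = 0" for w
  proof -
    have "(\<Sum>K\<in>\<Omega>. ?c K * cls K w) = (\<Sum>K\<in>{I, J}. ?c K * cls K w)"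
      using IJ by (intro sum.mono_neutral_right) auto
    also have "\<dots> = 0" using IJ by simp
    finally show ?thesis .
  qed
  then have "?c I = 0" by (rule cls_independent[OF _ IJ(1)])
  then show False by simp
qed

lemma top_in_\<Omega>: "{1..l1} \<in> \<Omega>"
  using n_eq by (auto simp: ksubsets_def)

lemma orbit_eq: "orbit (sym_group n) dot (cls {1..l1}) = cls ` \<Omega>"
proof (intro equalityI subsetI)
  fix g assume "g \<in> orbit (sym_group n) dot (cls {1..l1})"
  then obtain v where "v permutes {1..n}" "g = dot v (cls {1..l1})"
    by (auto simp: orbit_def sym_group_carrier)
  then show "g \<in> cls ` \<Omega>"
    using dot_cls permutes_image_ksubsets[OF _ top_in_\<Omega>] by simp
next
  fix g assume "g \<in> cls ` \<Omega>"
  then obtain I where I: "I \<in> \<Omega>" "g = cls I" by blast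
  have "coset_rep n l1 I permutes {1..n}" "coset_rep n l1 I ` {1..l1} = I"
    using n_eq by (intro coset_rep[OF _ I(1)]; simp)+
  then obtain v where v: "v permutes {1..n}" "v ` {1..l1} = I" by blast
  then have "g = dot v (cls {1..l1})" using dot_cls[OF v(1)] I(2) by simp
  then show "g \<in> orbit (sym_group n) dot (cls {1..l1})"
    using v(1) unfolding orbit_def sym_group_carrier by blast
qed

lemma stabilizer_cls:
  assumes "u permutes {1..n}"
  shows "stabilizer (sym_group n) dot (cls (u ` {1..l1})) = (\<lambda>y. u \<circ> y \<circ> inv' u) ` block_perms n l1"
proof -
  have "dot v (cls (u ` {1..l1})) = cls (u ` {1..l1}) \<longleftrightarrow> v ` (u ` {1..l1}) = u ` {1..l1}"
    if v: "v permutes {1..n}" for v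
    unfolding dot_cls[OF v] using inj_onD[OF inj_cls] permutes_image_ksubsets[OF v] permutes_image_ksubsets[OF assms top_in_\<Omega>]
    by metis
  then show ?thesis
    unfolding block_perms_conjugate[OF assms] stabilizer_def sym_group_carrier by blast
qed

definition comb :: "(nat set \<Rightarrow> cpoly) \<Rightarrow> (nat \<Rightarrow> nat) \<Rightarrow> cpoly" where
  "comb p = (\<Sum>I\<in>\<Omega>. psmult (p I) (cls I))"

lemma comb_apply: "comb p w = (\<Sum>I\<in>\<Omega>. p I * cls I w)"
  by (simp add: comb_def sum_fun_apply psmult_def)

lemma comb_cong: "(\<And>I. I \<in> \<Omega> \<Longrightarrow> p I = q I) \<Longrightarrow> comb p = comb q"
  by (simp add: comb_def)

lemma comb_add: "comb p + comb q = comb (\<lambda>I. p I + q I)"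
  by (rule ext) (simp add: comb_apply sum.distrib distrib_right)

lemma comb_diff: "comb p - comb q = comb (\<lambda>I. p I - q I)"
  by (rule ext) (simp add: comb_apply sum_subtractf left_diff_distrib)

lemma comb_0: "comb (\<lambda>I. 0) = 0"
  by (rule ext) (simp add: comb_apply)

lemma comb_psmult: "psmult r (comb p) = comb (\<lambda>I. r * p I)"
  by (rule ext) (simp add: comb_apply psmult_def sum_distrib_left mult.assoc)

lemma comb_sum: "(\<Sum>i\<in>A. comb (p i)) = comb (\<lambda>I. \<Sum>i\<in>A. p i I)"
  by (induction A rule: infinite_finite_induct) (simp_all add: comb_0 comb_add)

lemma comb_inject:
  assumes "comb p = comb q" "I \<in> \<Omega>" shows "p I = q I"
proof -
  have "(\<Sum>I\<in>\<Omega>. (p I - q I) * cls I w) = 0" for w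
    using fun_cong[OF assms(1), of w] by (simp add: comb_apply left_diff_distrib sum_subtractf)
  then have "p I - q I = 0" by (rule cls_independent[OF _ assms(2)])
  then show ?thesis by simp
qed

text \<open>Combinations over a finite part of the orbit become coefficient functions on all of
  \<open>\<Omega>\<close>, extended by \<open>0\<close>.\<close>

lemma sum_orbit:
  assumes "F \<subseteq> cls ` \<Omega>"
  shows "(\<Sum>x\<in>F. psmult (c x) x) = comb (\<lambda>I. if cls I \<in> F then c (cls I) else 0)"
proof -
  have "F = cls ` {I \<in> \<Omega>. cls I \<in> F}" using assms by blast
  then have "(\<Sum>x\<in>F. psmult (c x) x) = (\<Sum>I\<in>{I \<in> \<Omega>. cls I \<in> F}. psmult (c (cls I)) (cls I))"
    using sum.reindex[OF inj_on_subset[OF inj_cls], of "{I \<in> \<Omega>. cls I \<in> F}" "\<lambda>x. psmult (c x) x"]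
    by auto
  also have "\<dots> = (\<Sum>I\<in>\<Omega>. psmult (if cls I \<in> F then c (cls I) else 0) (cls I))"
    by (intro sum.mono_neutral_cong_left) (auto simp: psmult_def fun_eq_iff)
  finally show ?thesis unfolding comb_def .
qed

lemma sum_full_orbit: "(\<Sum>x\<in>cls ` \<Omega>. psmult (c x) x) = comb (\<lambda>I. c (cls I))"
  unfolding sum_orbit[OF order.refl] by (rule comb_cong) simp

lemma poly_independent_orbit: "poly_independent n (cls ` \<Omega>)"
  unfolding poly_independent_def
proof (intro allI impI ballI)
  fix F :: "((nat \<Rightarrow> nat) \<Rightarrow> cpoly) set" and c x
  assume F: "F \<subseteq> cls ` \<Omega>" and z: "(\<Sum>x\<in>F. psmult (c x) x) = 0" and x: "x \<in> F"
  obtain I where I: "I \<in> \<Omega>" "x = cls I" using F x by blast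
  have "(if cls I \<in> F then c (cls I) else 0) = 0"
    using z I(1) unfolding sum_orbit[OF F] comb_0[symmetric] by (rule comb_inject)
  then show "c x = 0" using I x by simp
qed

section \<open>The span, its quotient by the variables and the resulting character\<close>

definition comb_space :: "((nat \<Rightarrow> nat) \<Rightarrow> cpoly) set" where
  "comb_space = comb ` {p. \<forall>I\<in>\<Omega>. p I \<in> polyring n}"

definition augmented_space :: "((nat \<Rightarrow> nat) \<Rightarrow> cpoly) set" where
  "augmented_space = comb ` {p. \<forall>I\<in>\<Omega>. p I \<in> polyring n \<and> Poly_Mapping.lookup (p I) 0 = 0}"

lemma comb_spaceI: "(\<And>I. I \<in> \<Omega> \<Longrightarrow> p I \<in> polyring n) \<Longrightarrow> comb p \<in> comb_space"
  unfolding comb_space_def by blast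

lemma comb_spaceE:
  assumes "x \<in> comb_space" obtains p where "x = comb p" "\<And>I. I \<in> \<Omega> \<Longrightarrow> p I \<in> polyring n"
  using assms unfolding comb_space_def by blast

lemma augmented_spaceI:
  "(\<And>I. I \<in> \<Omega> \<Longrightarrow> p I \<in> polyring n) \<Longrightarrow> (\<And>I. I \<in> \<Omega> \<Longrightarrow> Poly_Mapping.lookup (p I) 0 = 0)
    \<Longrightarrow> comb p \<in> augmented_space"
  unfolding augmented_space_def by blast

lemma augmented_spaceE:
  assumes "x \<in> augmented_space" obtains p where "x = comb p" "\<And>I. I \<in> \<Omega> \<Longrightarrow> p I \<in> polyring n"
    "\<And>I. I \<in> \<Omega> \<Longrightarrow> Poly_Mapping.lookup (p I) 0 = 0"
  using assms unfolding augmented_space_def by blast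

lemma comb_in_augmented_space_iff:
  assumes "\<And>I. I \<in> \<Omega> \<Longrightarrow> p I \<in> polyring n"
  shows "comb p \<in> augmented_space \<longleftrightarrow> (\<forall>I\<in>\<Omega>. Poly_Mapping.lookup (p I) 0 = 0)"
proof
  assume "comb p \<in> augmented_space"
  then obtain q where q: "comb p = comb q" "\<And>I. I \<in> \<Omega> \<Longrightarrow> q I \<in> polyring n"
    "\<And>I. I \<in> \<Omega> \<Longrightarrow> Poly_Mapping.lookup (q I) 0 = 0"
    by (rule augmented_spaceE) blast
  show "\<forall>I\<in>\<Omega>. Poly_Mapping.lookup (p I) 0 = 0" using comb_inject[OF q(1)] q(3) by simp
qed (use assms in \<open>blast intro: augmented_spaceI\<close>)

lemma poly_span_orbit: "poly_span n (cls ` \<Omega>) = comb_space"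
proof (intro equalityI subsetI)
  fix x assume "x \<in> poly_span n (cls ` \<Omega>)"
  then obtain F c where "F \<subseteq> cls ` \<Omega>" "c \<in> F \<rightarrow> polyring n" "x = (\<Sum>x\<in>F. psmult (c x) x)"
    unfolding poly_span_def by blast
  then show "x \<in> comb_space" by (auto simp: sum_orbit intro!: comb_spaceI)
next
  fix x assume "x \<in> comb_space"
  then obtain p where p: "x = comb p" "\<And>I. I \<in> \<Omega> \<Longrightarrow> p I \<in> polyring n" by (rule comb_spaceE) blast
  let ?c = "\<lambda>x. p (inv_into \<Omega> cls x)"
  have c: "?c (cls I) = p I" if "I \<in> \<Omega>" for I
    using inv_into_f_f[OF inj_cls that] by simp
  have "x = (\<Sum>x\<in>cls ` \<Omega>. psmult (?c x) x)"
    unfolding sum_full_orbit p(1) by (rule comb_cong) (simp add: c)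
  moreover have "?c \<in> cls ` \<Omega> \<rightarrow> polyring n" using c p(2) by auto
  ultimately show "x \<in> poly_span n (cls ` \<Omega>)"
    unfolding poly_span_def
    by (intro CollectI exI[of _ "cls ` \<Omega>"] exI[of _ ?c]) simp
qed

text \<open>A combination of multiples by variables has coefficients without constant terms.
  Conversely, each such coefficient is decomposed along the variables, and the summands belonging to
  \<open>t_i\<close> are collected into one combination.\<close>

lemma augmented_comb_space: "augmented n comb_space = augmented_space"
proof (intro equalityI subsetI)
  fix x assume "x \<in> augmented n comb_space"
  then obtain g where g: "g \<in> {1..n} \<rightarrow> comb_space" "x = (\<Sum>i\<in>{1..n}. psmult (tvar i) (g i))"
    unfolding augmented_def by blast
  then have "\<forall>i\<in>{1..n}. \<exists>q. g i = comb q \<and> (\<forall>I\<in>\<Omega>. q I \<in> polyring n)"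
    unfolding comb_space_def by fastforce
  then obtain q where q: "\<And>i. i \<in> {1..n} \<Longrightarrow> g i = comb (q i)"
    "\<And>i I. i \<in> {1..n} \<Longrightarrow> I \<in> \<Omega> \<Longrightarrow> q i I \<in> polyring n"
    by metis
  have "x = (\<Sum>i\<in>{1..n}. comb (\<lambda>I. tvar i * q i I))"
    unfolding g(2) by (intro sum.cong) (simp_all add: q comb_psmult)
  also have "\<dots> = comb (\<lambda>I. \<Sum>i\<in>{1..n}. tvar i * q i I)" by (rule comb_sum)
  also have "\<dots> \<in> augmented_space"
  proof (rule augmented_spaceI)
    show "(\<Sum>i\<in>{1..n}. tvar i * q i I) \<in> polyring n" if "I \<in> \<Omega>" for I
      by (intro polyring_sum polyring_mult polyring_tvar q(2)[OF _ that])
  qed (simp add: lookup_sum)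
  finally show "x \<in> augmented_space" .
next
  fix x assume "x \<in> augmented_space"
  then obtain p where p: "x = comb p" "\<And>I. I \<in> \<Omega> \<Longrightarrow> p I \<in> polyring n"
    "\<And>I. I \<in> \<Omega> \<Longrightarrow> Poly_Mapping.lookup (p I) 0 = 0" by (rule augmented_spaceE) blast
  have "\<forall>I\<in>\<Omega>. \<exists>q. q \<in> {1..n} \<rightarrow> polyring n \<and> p I = (\<Sum>i\<in>{1..n}. tvar i * q i)"
    using polyring_decompose[OF p(2)] p(3) by fastforce
  then obtain q where q: "\<And>I. I \<in> \<Omega> \<Longrightarrow> q I \<in> {1..n} \<rightarrow> polyring n"
    "\<And>I. I \<in> \<Omega> \<Longrightarrow> p I = (\<Sum>i\<in>{1..n}. tvar i * q I i)" by metis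
  have "x = comb (\<lambda>I. \<Sum>i\<in>{1..n}. tvar i * q I i)"
    unfolding p(1) by (rule comb_cong) (rule q(2))
  also have "\<dots> = (\<Sum>i\<in>{1..n}. psmult (tvar i) (comb (\<lambda>I. q I i)))"
    unfolding comb_psmult by (rule comb_sum[symmetric])
  finally have "x = (\<Sum>i\<in>{1..n}. psmult (tvar i) (comb (\<lambda>I. q I i)))" .
  moreover have "(\<lambda>i. comb (\<lambda>I. q I i)) \<in> {1..n} \<rightarrow> comb_space"
    using q(1) by (auto intro!: comb_spaceI)
  ultimately show "x \<in> augmented n comb_space"
    unfolding augmented_def by (intro CollectI exI[of _ "\<lambda>i. comb (\<lambda>I. q I i)"] conjI)
qed

text \<open>Semilinearity in coefficients: \<open>v\<close> acts on each polynomial and also moves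
  its label, whence the shift by \<open>inv' v\<close>.\<close>

lemma dot_comb:
  assumes v: "v permutes {1..n}"
  shows "dot v (comb p) = comb (\<lambda>I. perm_poly v (p (inv' v ` I)))"
proof (rule ext)
  fix w
  have inv_v: "inv' v ` (v ` I) = I" for I
    by (rule image_inv_f_f[OF permutes_inj[OF v]])
  have bij: "bij_betw ((`) v) \<Omega> \<Omega>"
    by (rule bij_betw_byWitness[of _ "(`) (inv' v)"])
      (use inv_v image_f_inv_f[OF permutes_surj[OF v]] permutes_image_ksubsets[OF v]
        permutes_image_ksubsets[OF permutes_inv[OF v]] in auto)
  have "dot v (comb p) w = (\<Sum>I\<in>\<Omega>. perm_poly v (p I) * dot v (cls I) w)"
    by (simp add: dot_def comb_apply perm_poly_sum perm_poly_mult)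
  also have "\<dots> = (\<Sum>I\<in>\<Omega>. perm_poly v (p (inv' v ` (v ` I))) * cls (v ` I) w)"
    unfolding dot_cls[OF v] inv_v ..
  also have "\<dots> = comb (\<lambda>I. perm_poly v (p (inv' v ` I))) w"
    unfolding comb_apply by (rule sum.reindex_bij_betw[OF bij])
  finally show "dot v (comb p) w = comb (\<lambda>I. perm_poly v (p (inv' v ` I))) w" .
qed

lemma dot_comb_space:
  assumes v: "v permutes {1..n}" and "x \<in> comb_space" shows "dot v x \<in> comb_space"
proof -
  obtain p where p: "x = comb p" "\<And>I. I \<in> \<Omega> \<Longrightarrow> p I \<in> polyring n"
    using assms(2) by (rule comb_spaceE) blast
  show ?thesis unfolding p(1) dot_comb[OF v]
    by (intro comb_spaceI perm_poly_polyring[OF _ v] p(2) permutes_image_ksubsets[OF permutes_inv[OF v]])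
qed

lemma dot_augmented_space:
  assumes v: "v permutes {1..n}" and "x \<in> augmented_space" shows "dot v x \<in> augmented_space"
proof -
  obtain p where p: "x = comb p" "\<And>I. I \<in> \<Omega> \<Longrightarrow> p I \<in> polyring n"
    "\<And>I. I \<in> \<Omega> \<Longrightarrow> Poly_Mapping.lookup (p I) 0 = 0"
    using assms(2) by (rule augmented_spaceE) blast
  note inv = permutes_image_ksubsets[OF permutes_inv[OF v]]
  show ?thesis unfolding p(1) dot_comb[OF v]
    by (intro augmented_spaceI perm_poly_polyring[OF _ v] augmentation_perm_poly[where n = n] p inv)
qed

lemma comb_space_subset_HT: "comb_space \<subseteq> HT n h"
proof
  fix x assume "x \<in> comb_space"
  then obtain p where p: "x = comb p" "\<And>I. I \<in> \<Omega> \<Longrightarrow> p I \<in> polyring n" by (rule comb_spaceE) blast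
  have "(\<Sum>I\<in>K. psmult (p I) (cls I)) \<in> HT n h" if "K \<subseteq> \<Omega>" for K
    using finite_subset[OF that finite_ksubsets] that
    by (induction K rule: finite_induct) (simp_all add: HT_0 HT_add HT_psmult cls_in_HT p(2))
  then show "x \<in> HT n h" unfolding p(1) comb_def by blast
qed

lemma comb_space_0: "0 \<in> comb_space"
  unfolding comb_0[symmetric] by (rule comb_spaceI) simp

lemma comb_space_add: "x \<in> comb_space \<Longrightarrow> y \<in> comb_space \<Longrightarrow> x + y \<in> comb_space"
  by (elim comb_spaceE) (simp add: comb_add comb_spaceI)

lemma comb_space_psmult: "r \<in> polyring n \<Longrightarrow> x \<in> comb_space \<Longrightarrow> psmult r x \<in> comb_space"
  by (elim comb_spaceE) (simp add: comb_psmult comb_spaceI)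

lemma HT_subrep_comb_space: "HT_subrep n h comb_space"
  unfolding HT_subrep_def
  using comb_space_subset_HT comb_space_0 comb_space_add comb_space_psmult dot_comb_space by blast

text \<open>Modulo \<open>augmented_space\<close> only constant terms of the coefficients survive.
  The orbit thus becomes a complex basis of the quotient, and it is permuted like
  \<open>\<Omega>\<close>.\<close>

lemma HT_character_comb_space:
  assumes v: "v permutes {1..n}"
  shows "HT_character n comb_space v = of_nat (card {I \<in> \<Omega>. v ` I = I})"
proof -
  let ?s = "\<lambda>c. psmult (pconst c)"
  interpret vector_space ?s by (rule vector_space_psmult_pconst)
  have aug0: "0 \<in> augmented_space"
    unfolding comb_0[symmetric] by (rule augmented_spaceI) simp_all
  have aug_add: "x + y \<in> augmented_space" if "x \<in> augmented_space" "y \<in> augmented_space" for x y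
    using that by (elim augmented_spaceE) (simp add: comb_add augmented_spaceI lookup_add)
  have aug_scale: "?s c x \<in> augmented_space" if x: "x \<in> augmented_space" for c x
  proof -
    obtain p where p: "x = comb p" "\<And>I. I \<in> \<Omega> \<Longrightarrow> p I \<in> polyring n"
      "\<And>I. I \<in> \<Omega> \<Longrightarrow> Poly_Mapping.lookup (p I) 0 = 0"
      using x by (rule augmented_spaceE) blast
    have "Poly_Mapping.lookup (pconst c * p I) 0 = 0" if I: "I \<in> \<Omega>" for I
    proof -
      obtain q where "p I = pconst (Poly_Mapping.lookup (p I) 0) + (\<Sum>i\<in>{1..n}. tvar i * q i)"
        using polyring_decompose[OF p(2)[OF I]] by blast
      then have "pconst c * p I = (\<Sum>i\<in>{1..n}. tvar i * (pconst c * q i))"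
        using p(3)[OF I] by (simp add: sum_distrib_left mult.left_commute)
      then show ?thesis by (simp add: lookup_sum)
    qed
    then show ?thesis unfolding p(1) comb_psmult by (intro augmented_spaceI polyring_mult p polyring_pconst)
  qed
  interpret Q: quotient_map ?s comb_space augmented_space "dot v"
  proof (unfold_locales)
    show "subspace comb_space"
      using comb_space_0 comb_space_add comb_space_psmult polyring_pconst unfolding subspace_def by blast
    show "subspace augmented_space"
      using aug0 aug_add aug_scale unfolding subspace_def by blast
    show "augmented_space \<subseteq> comb_space" unfolding augmented_space_def comb_space_def by blast
    show "dot v x \<in> comb_space" if "x \<in> comb_space" for x using that by (rule dot_comb_space[OF v])
    show "dot v x \<in> augmented_space" if "x \<in> augmented_space" for x using that by (rule dot_augmented_space[OF v])
  qed (simp_all add: dot_def psmult_def fun_eq_iff perm_poly_add perm_poly_mult)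
  have basis: "is_quot_basis ?s comb_space augmented_space (cls ` \<Omega>)"
    unfolding is_quot_basis_def
  proof (intro conjI ballI)
    show "cls ` \<Omega> \<subseteq> comb_space"
    proof (rule image_subsetI)
      fix I assume I: "I \<in> \<Omega>"
      have "cls I = comb (\<lambda>J. if J = I then 1 else 0)"
      proof (rule ext)
        fix w
        have "comb (\<lambda>J. if J = I then 1 else 0) w = (\<Sum>J\<in>\<Omega>. if J = I then cls I w else 0)"
          unfolding comb_apply by (rule sum.cong) auto
        then show "cls I w = comb (\<lambda>J. if J = I then 1 else 0) w" using I by simp
      qed
      then show "cls I \<in> comb_space" by (auto intro!: comb_spaceI)
    qed
  next
    fix x assume "x \<in> comb_space"
    then obtain p where p: "x = comb p" "\<And>I. I \<in> \<Omega> \<Longrightarrow> p I \<in> polyring n" by (rule comb_spaceE) blast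
    \<comment> \<open>The coordinates of \<open>comb p\<close> in the quotient are the constant
      terms of \<open>p\<close>.\<close>
    have iff: "x - (\<Sum>b\<in>cls ` \<Omega>. ?s (c b) b) \<in> augmented_space \<longleftrightarrow>
        (\<forall>I\<in>\<Omega>. c (cls I) = Poly_Mapping.lookup (p I) 0)" for c
    proof -
      have eq: "x - (\<Sum>b\<in>cls ` \<Omega>. ?s (c b) b) = comb (\<lambda>I. p I - pconst (c (cls I)))"
        unfolding sum_full_orbit p(1) comb_diff ..
      show ?thesis unfolding eq
        by (subst comb_in_augmented_space_iff) (auto simp: p(2) lookup_minus intro!: polyring_diff)
    qed
    define c0 where "c0 = restrict (\<lambda>b. Poly_Mapping.lookup (p (inv_into \<Omega> cls b)) 0) (cls ` \<Omega>)"
    have c0: "c0 (cls I) = Poly_Mapping.lookup (p I) 0" if "I \<in> \<Omega>" for I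
      using that by (simp add: c0_def inv_into_f_f[OF inj_cls])
    show "\<exists>!c. c \<in> extensional (cls ` \<Omega>) \<and> x - (\<Sum>b\<in>cls ` \<Omega>. ?s (c b) b) \<in> augmented_space"
      unfolding iff
    proof (rule ex1I[of _ c0])
      show "c0 \<in> extensional (cls ` \<Omega>) \<and> (\<forall>I\<in>\<Omega>. c0 (cls I) = Poly_Mapping.lookup (p I) 0)"
        using c0 unfolding c0_def by simp
    next
      fix c assume c: "c \<in> extensional (cls ` \<Omega>) \<and> (\<forall>I\<in>\<Omega>. c (cls I) = Poly_Mapping.lookup (p I) 0)"
      show "c = c0"
      proof (rule extensionalityI)
        show "c \<in> extensional (cls ` \<Omega>)" using c by blast
        show "c0 \<in> extensional (cls ` \<Omega>)" by (simp add: c0_def)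
        show "c b = c0 b" if "b \<in> cls ` \<Omega>" for b using that c c0 by auto
      qed
    qed
  qed simp
  show ?thesis unfolding HT_character_def augmented_comb_space
    by (rule Q.quot_trace_permuted_basis[OF basis inj_cls permutes_image_ksubsets[OF v] dot_cls[OF v]])
qed

end

theorem theorem5p1:
  fixes n l1 l2 :: nat and h :: "nat \<Rightarrow> nat"
  assumes "n \<ge> 2"
    and "hessenberg_fun n h"
    and "l1 \<ge> 1" and "l2 \<ge> 1" and "l1 + l2 = n"
    and "h 1 < l2"
    and "l1 > 1 \<Longrightarrow> h (l2 + 1) = n"
    and "l1 > 1 \<Longrightarrow>
           (let J = {b \<in> {l1 + 1..n - 1}. l2 \<le> h (inv' (vperm n l1 (l2 - 1)) b)}
            in J \<noteq> {} \<longrightarrow> h (inv' (vperm n l1 (l2 - 1)) (Min J)) \<le> l2 + 1)"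
  shows "let f = fclass n h l1 (l2 - 1);
             Orb = orbit (sym_group n) dot f;
             N = poly_span n Orb;
             Young = young_subgroup n l1
         in f \<in> HT n h \<and>
            poly_independent n Orb \<and>
            (\<forall>g\<in>Orb. \<exists>u. u permutes {1..n} \<and>
               stabilizer (sym_group n) dot g = (\<lambda>y. u \<circ> y \<circ> inv' u) ` Young) \<and>
            HT_subrep n h N \<and>
            (\<forall>v. v permutes {1..n} \<longrightarrow> HT_character n N v = ind_character n Young v) \<and>
            rep_iso n (ind_trivial n Young) left_translate
              (perm_module n (Par [l1, l2])) tabloid_act"
proof -
  interpret two_part_class n l1 l2 h
    using assms by unfold_locales auto
  have l1n: "l1 \<le> n" using n_eq by simp
  have Young: "young_subgroup n l1 = block_perms n l1" by (rule young_subgroup_eq[OF l1 l1n])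
  have stab: "\<exists>u. u permutes {1..n} \<and> stabilizer (sym_group n) dot g = (\<lambda>y. u \<circ> y \<circ> inv' u) ` block_perms n l1"
    if g: "g \<in> orbit (sym_group n) dot (cls {1..l1})" for g
  proof -
    obtain u where u: "u permutes {1..n}" "g = cls (u ` {1..l1})"
      using g dot_cls by (auto simp: orbit_def sym_group_carrier)
    then show ?thesis using stabilizer_cls by blast
  qed
  show ?thesis
    unfolding Let_def Young fclass_eq_cls orbit_eq poly_span_orbit
  proof (intro conjI ballI allI impI)
    show "cls {1..l1} \<in> HT n h" by (rule cls_in_HT)
    show "poly_independent n (cls ` \<Omega>)" by (rule poly_independent_orbit)
    show "\<exists>u. u permutes {1..n} \<and> stabilizer (sym_group n) dot g = (\<lambda>y. u \<circ> y \<circ> inv' u) ` block_perms n l1"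
      if "g \<in> cls ` \<Omega>" for g
      using stab that unfolding orbit_eq .
    show "HT_subrep n h comb_space" by (rule HT_subrep_comb_space)
    \<comment> \<open>Both characters count the \<open>l1\<close>-element subsets that
      \<open>v\<close> maps onto themselves.\<close>
    show "HT_character n comb_space v = ind_character n (block_perms n l1) v"
      if "v permutes {1..n}" for v
      unfolding HT_character_comb_space[OF that] ind_character_eq[OF l1n that] ..
    show "rep_iso n (ind_trivial n (block_perms n l1)) left_translate
        (perm_module n (Par [l1, l2])) tabloid_act"
      by (rule rep_iso_ind_trivial_perm_module[OF n_eq])
  qed
qed

end
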